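(* Let $m>0$ and let $a(\eta)=\alpha\eta$ for $\eta>0$, with $\alpha>0$ a constant (radiation-filled, spatially flat cosmos); put $\tilde m=\alpha m$. Let $\vec k\in\mathbb{R}^3$, $k=|\vec k|$. Then $$g_k(\eta)=\frac{e^{-\pi k^2/(8\tilde m)}}{\sqrt{2m}\,a(\eta)^{1/2}}\,W_{\lambda,\frac14}(i\tilde m\eta^2),\qquad \lambda=\frac{-ik^2}{4\tilde m},$$ where $W_{\lambda,\mu}$ is the Whittaker function, satisfies the mode equation and the Wronskian normalization given in the context, $$\lim_{\Lambda\to\infty}\frac{|\langle g_k,\bar g_k\rangle_{\eta,\Lambda}|}{\langle g_k,g_k\rangle_{\eta,\Lambda}}=0,$$ and consequently the S-J mode functions with cutoff $\Lambda$ built from $g_k$ converge pointwise, as $\Lambda\to\infty$, to $$\mathcal{U}^{SJ}_{\vec k}(\eta,\vec x)=\frac{e^{i\vec k\cdot\vec x}\,e^{-\pi k^2/(8\tilde m)}}{\sqrt{2m(2\pi)^3}\,a(\eta)^{3/2}}\,W_{\frac{-ik^2}{4\tilde m},\frac14}(i\tilde m\eta^2).$$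
   Context: The spacetime is $\{(\eta,\vec x):\eta>0,\ \vec x\in\mathbb{R}^3\}$ with metric $ds^2=a(\eta)^2[d\eta^2-d\vec x^2]$; the field is a free scalar of mass $m$ satisfying $(\nabla^\mu\nabla_\mu+m^2)\phi=0$. A mode $u_{\vec k}(\eta,\vec x)=\frac{e^{i\vec k\cdot\vec x}}{(2\pi)^{3/2}}\frac{g_k(\eta)}{a(\eta)}$ is used, where $g_k$ satisfies the mode equation $\left(\partial_\eta^2+k^2+m^2a^2-\frac{a''}{a}\right)g_k=0$ and the Wronskian normalization $g_k\,\partial_\eta\bar g_k-\bar g_k\,\partial_\eta g_k=i$ (bar is complex conjugation). $W_{\lambda,\mu}(z)$ is the standard (principal branch) Whittaker function: the solution of $W''+\left(-\frac14+\frac{\lambda}{z}+\frac{\frac14-\mu^2}{z^2}\right)W=0$ with $W_{\lambda,\mu}(z)\sim e^{-z/2}z^{\lambda}$ as $z\to\infty$, $|\arg z|<\frac{3\pi}{2}$. For a cutoff $\Lambda>0$ put $\langle f,h\rangle_{\eta,\Lambda}=\int_0^\Lambda \bar f(\eta)h(\eta)a(\eta)^2\,d\eta$. With $r_\Lambda=\frac{|\langle g_k,\bar g_k\rangle_{\eta,\Lambda}|}{\langle g_k,g_k\rangle_{\eta,\Lambda}}$ (so $0\le r_\Lambda<1$), the S-J mode function with cutoff $\Lambda$ (obtained by diagonalizing the integral operator $i\Delta$, where $\Delta$ is the Pauli-Jordan function, on the slab $0<\eta<\Lambda$) is $$\mathcal{U}^{SJ,\Lambda}_{\vec k}(\eta,\vec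 x)=\frac{e^{i\vec k\cdot\vec x}}{\sqrt{2(2\pi)^3}\,a(\eta)}\left\{\sqrt{1+\tfrac{1}{\sqrt{1-r_\Lambda^2}}}\;g_k(\eta)-\sqrt{-1+\tfrac{1}{\sqrt{1-r_\Lambda^2}}}\;e^{i\,\mathrm{Arg}\langle\bar g_k,g_k\rangle_{\eta,\Lambda}}\;\bar g_k(\eta)\right\}.$$ (When $\langle\bar g_k,g_k\rangle_{\eta,\Lambda}=0$ the second coefficient vanishes and the value of $\mathrm{Arg}$ is irrelevant.) *)

theory Defs
  imports "HOL-Analysis.Analysis"
begin

text \<open>
  The Whittaker function lives on the Riemann surface of the logarithm, and its defining asymptotics
  are required for \<open>\<bar>arg z\<bar> < 3\<pi>/2\<close>, i.e. beyond the principal sheet. A solution \<open>W\<close> on that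
  sector is therefore encoded by \<open>F \<zeta> = W (exp \<zeta>)\<close> with \<open>\<zeta> = log z\<close> in the strip
  \<open>\<bar>Im \<zeta>\<bar> < 3\<pi>/2\<close>. In this coordinate \<open>d/dz\<close> is \<open>exp (-\<zeta>) d/d\<zeta>\<close> and \<open>z\<^sup>\<lambda>\<close> is \<open>exp (\<lambda> \<zeta>)\<close>.
\<close>

definition z_deriv :: "(complex \<Rightarrow> complex) \<Rightarrow> complex \<Rightarrow> complex" where
  "z_deriv F \<zeta> = deriv F \<zeta> / exp \<zeta>"

text \<open>
  As usual, the asymptotic relation for \<open>\<bar>arg z\<bar> < 3\<pi>/2\<close> means \<open>z \<rightarrow> \<infinity>\<close> within each closed
  subsector \<open>\<bar>arg z\<bar> \<le> 3\<pi>/2 - \<delta>\<close>.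
\<close>

definition whittaker_solution :: "complex \<Rightarrow> complex \<Rightarrow> (complex \<Rightarrow> complex) \<Rightarrow> bool" where
  "whittaker_solution l \<mu> F \<longleftrightarrow>
     F holomorphic_on {\<zeta>. \<bar>Im \<zeta>\<bar> < 3 * pi / 2} \<and>
     (\<forall>\<zeta>. \<bar>Im \<zeta>\<bar> < 3 * pi / 2 \<longrightarrow>
        z_deriv (z_deriv F) \<zeta>
          + (- 1 / 4 + l / exp \<zeta> + (1 / 4 - \<mu>\<^sup>2) / (exp \<zeta>)\<^sup>2) * F \<zeta> = 0) \<and>
     (\<forall>\<delta>>0. ((\<lambda>\<zeta>. F \<zeta> / (exp (- exp \<zeta> / 2) * exp (l * \<zeta>))) \<longlongrightarrow> 1)
        (inf (filtercomap Re at_top) (principal {\<zeta>. \<bar>Im \<zeta>\<bar> \<le> 3 * pi / 2 - \<delta>})))"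

text \<open>The principal branch; the value at \<open>z = 0\<close> is irrelevant.\<close>

definition whittaker_W :: "complex \<Rightarrow> complex \<Rightarrow> complex \<Rightarrow> complex" where
  "whittaker_W l \<mu> z = (THE w. \<exists>F. whittaker_solution l \<mu> F \<and> w = F (Ln z))"

definition mode_equation ::
    "real \<Rightarrow> (real \<Rightarrow> real) \<Rightarrow> real \<Rightarrow> (real \<Rightarrow> complex) \<Rightarrow> bool" where
  "mode_equation m a k g \<longleftrightarrow>
     (\<exists>g' g''. \<forall>\<eta>>0.
        (g has_vector_derivative g' \<eta>) (at \<eta>) \<and>
        (g' has_vector_derivative g'' \<eta>) (at \<eta>) \<and>
        g'' \<eta> + of_real (k\<^sup>2 + m\<^sup>2 * (a \<eta>)\<^sup>2 - deriv (deriv a) \<eta> / a \<eta>) * g \<eta> = 0)"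

definition wronskian_normalized :: "(real \<Rightarrow> complex) \<Rightarrow> bool" where
  "wronskian_normalized g \<longleftrightarrow>
     (\<forall>\<eta>>0. g differentiable (at \<eta>) \<and>
        g \<eta> * vector_derivative (\<lambda>t. cnj (g t)) (at \<eta>)
          - cnj (g \<eta>) * vector_derivative g (at \<eta>) = \<i>)"

definition eta_integrand ::
    "(real \<Rightarrow> real) \<Rightarrow> (real \<Rightarrow> complex) \<Rightarrow> (real \<Rightarrow> complex) \<Rightarrow> real \<Rightarrow> complex" where
  "eta_integrand a f h \<eta> = cnj (f \<eta>) * h \<eta> * of_real ((a \<eta>)\<^sup>2)"

definition eta_inner ::
    "(real \<Rightarrow> real) \<Rightarrow> real \<Rightarrow> (real \<Rightarrow> complex) \<Rightarrow> (real \<Rightarrow> complex) \<Rightarrow> complex" where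
  "eta_inner a \<Lambda> f h = (LBINT \<eta>:{0<..<\<Lambda>}. eta_integrand a f h \<eta>)"

abbreviation conj_fun :: "(real \<Rightarrow> complex) \<Rightarrow> real \<Rightarrow> complex" where
  "conj_fun g \<equiv> (\<lambda>\<eta>. cnj (g \<eta>))"

text \<open>\<open>\<langle>g, g\<rangle>\<close> is real, so \<open>Re\<close> only changes the type.\<close>

definition SJ_ratio :: "(real \<Rightarrow> real) \<Rightarrow> (real \<Rightarrow> complex) \<Rightarrow> real \<Rightarrow> real" where
  "SJ_ratio a g \<Lambda> = cmod (eta_inner a \<Lambda> g (conj_fun g)) / Re (eta_inner a \<Lambda> g g)"

definition SJ_mode ::
    "(real \<Rightarrow> real) \<Rightarrow> (real \<Rightarrow> complex) \<Rightarrow> real^3 \<Rightarrow> real \<Rightarrow> real \<Rightarrow> real^3 \<Rightarrow> complex" where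
  "SJ_mode a g kv \<Lambda> \<eta> x =
     exp (\<i> * of_real (kv \<bullet> x)) / of_real (sqrt (2 * (2 * pi) ^ 3) * a \<eta>) *
     (of_real (sqrt (1 + 1 / sqrt (1 - (SJ_ratio a g \<Lambda>)\<^sup>2))) * g \<eta>
      - of_real (sqrt (- 1 + 1 / sqrt (1 - (SJ_ratio a g \<Lambda>)\<^sup>2)))
          * exp (\<i> * of_real (Arg (eta_inner a \<Lambda> (conj_fun g) g))) * cnj (g \<eta>))"

end

theory Submission
  imports Defs "HOL-Complex_Analysis.Complex_Analysis" "HOL-Real_Asymp.Real_Asymp"
begin

text \<open>
  Existence of the Whittaker function comes from the Laplace integral for \<open>U(a, 1 + 2\<mu>, z)\<close> along a
  ray of argument \<open>\<phi>\<close>, which converges for \<open>\<bar>arg z + \<phi>\<bar> < \<pi>/2\<close>; letting \<open>\<phi>\<close> range over \<open>(- \<pi>, \<pi>)\<close>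
  covers \<open>\<bar>arg z\<bar> < 3\<pi>/2\<close>. Two solutions with the prescribed asymptotics agree as soon as their
  common sector meets \<open>Re z > 0\<close>, where the solution is recessive. This yields uniqueness and also
  glues the integrals for different \<open>\<phi>\<close>.

  On the ray \<open>arg z = \<pi>/2\<close> the asymptotics give \<open>\<eta> \<bar>g\<bar>\<^sup>2 \<rightarrow> 1 / (2 m \<alpha>)\<close> and \<open>g' \<sim> - i \<alpha> m \<eta> g\<close>. Hence the
  constant Wronskian is \<open>i\<close>, the norm \<open>\<langle>g, g\<rangle>\<close> grows like \<open>\<Lambda>\<^sup>2\<close>, and a virial identity shows that
  \<open>\<langle>g, cnj g\<rangle>\<close> is \<open>o(\<Lambda>\<^sup>2)\<close>.
\<close>

section \<open>Whittaker's equation in the logarithmic coordinate\<close>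

text \<open>\<open>whittaker_W\<close> is a definite description over functions on the whole strip
  of width 3 pi. Its value on the single ray arg z = pi/2, the only one that enters g, is therefore
  available only after existence and uniqueness on the full strip. The Laplace integral along the
  positive axis serves Re z > 0, so this ray lies on the boundary of its domain; hence the path of
  integration has to turn.

  Convergence at u = 0 asks for Re (\<mu> - l + 1/2) > 0, and a bounded factor (1+u)^c for Re (\<mu>
  + l - 1/2) <= 0. With \<mu> = 1/4 and l purely imaginary these real parts are 3/4 and -1/4.

  On arg z = pi/2 the factor e^(-z/2) has modulus 1 and z^l has modulus exp (pi k^2 / (8 mt)). The
  exponential in the definition of g is the reciprocal of that number. This is what makes the limit
  of \<eta> |g|^2 independent of k and the Wronskian equal to i.\<close>

definition horizontal_strip :: "real \<Rightarrow> real \<Rightarrow> complex set" where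
  "horizontal_strip \<alpha> \<beta> = {\<zeta>. \<alpha> < Im \<zeta> \<and> Im \<zeta> < \<beta>}"

lemma horizontal_strip_open [simp]: "open (horizontal_strip \<alpha> \<beta>)"
  and horizontal_strip_convex: "convex (horizontal_strip \<alpha> \<beta>)"
proof -
  have eq: "horizontal_strip \<alpha> \<beta> = {\<zeta>. Im \<zeta> > \<alpha>} \<inter> {\<zeta>. Im \<zeta> < \<beta>}"
    by (auto simp: horizontal_strip_def)
  show "open (horizontal_strip \<alpha> \<beta>)"
    unfolding eq by (intro open_Int open_halfspace_Im_gt open_halfspace_Im_lt)
  show "convex (horizontal_strip \<alpha> \<beta>)"
    unfolding eq by (intro convex_Int convex_halfspace_Im_gt convex_halfspace_Im_lt)
qed

definition whittaker_ode :: "complex \<Rightarrow> complex \<Rightarrow> complex set \<Rightarrow> (complex \<Rightarrow> complex) \<Rightarrow> bool" where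
  "whittaker_ode l \<mu> S F \<longleftrightarrow> F holomorphic_on S \<and>
     (\<forall>\<zeta>\<in>S. z_deriv (z_deriv F) \<zeta>
        + (- 1 / 4 + l / exp \<zeta> + (1 / 4 - \<mu>\<^sup>2) / (exp \<zeta>)\<^sup>2) * F \<zeta> = 0)"

text \<open>The denominator is the prescribed leading term e^(-z/2) z^l written in \<zeta> = log z.
  It has no zeros, so the quotient is holomorphic wherever F is.\<close>

definition whittaker_amplitude :: "complex \<Rightarrow> (complex \<Rightarrow> complex) \<Rightarrow> complex \<Rightarrow> complex" where
  "whittaker_amplitude l F \<zeta> = F \<zeta> / (exp (- exp \<zeta> / 2) * exp (l * \<zeta>))"

text \<open>Uniformity in Im \<zeta> over closed substrips is part of the notion: Cauchy's estimate
  needs the limit on discs, not merely on a ray. Arbitrary ends allow the strips of single Laplace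
  integrals and their overlaps.\<close>

definition tends_to_one :: "real \<Rightarrow> real \<Rightarrow> (complex \<Rightarrow> complex) \<Rightarrow> bool" where
  "tends_to_one \<alpha> \<beta> R \<longleftrightarrow> (\<forall>\<alpha>'>\<alpha>. \<forall>\<beta>'<\<beta>. \<forall>\<epsilon>>0. \<exists>T. \<forall>\<zeta>.
     T \<le> Re \<zeta> \<and> \<alpha>' \<le> Im \<zeta> \<and> Im \<zeta> \<le> \<beta>' \<longrightarrow> norm (R \<zeta> - 1) < \<epsilon>)"

lemma tendsto_right_end_iff:
  fixes R :: "complex \<Rightarrow> complex"
  shows "(R \<longlongrightarrow> c) (inf (filtercomap Re at_top) (principal S)) \<longleftrightarrow>
     (\<forall>\<epsilon>>0. \<exists>T. \<forall>\<zeta>\<in>S. T \<le> Re \<zeta> \<longrightarrow> norm (R \<zeta> - c) < \<epsilon>)"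
  unfolding tendsto_iff eventually_inf_principal eventually_filtercomap
    eventually_at_top_linorder dist_norm
proof (intro all_cong iffI)
  fix e :: real
  assume "\<exists>Q. (\<exists>N. \<forall>n\<ge>N. Q n) \<and> (\<forall>x. Q (Re x) \<longrightarrow> x \<in> S \<longrightarrow> cmod (R x - c) < e)"
  then show "\<exists>T. \<forall>\<zeta>\<in>S. T \<le> Re \<zeta> \<longrightarrow> cmod (R \<zeta> - c) < e" by blast
next
  fix e :: real
  assume "\<exists>T. \<forall>\<zeta>\<in>S. T \<le> Re \<zeta> \<longrightarrow> cmod (R \<zeta> - c) < e"
  then obtain T where "\<forall>\<zeta>\<in>S. T \<le> Re \<zeta> \<longrightarrow> cmod (R \<zeta> - c) < e" ..
  then show "\<exists>Q. (\<exists>N. \<forall>n\<ge>N. Q n) \<and> (\<forall>x. Q (Re x) \<longrightarrow> x \<in> S \<longrightarrow> cmod (R x - c) < e)"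
    by (intro exI[of _ "\<lambda>n. T \<le> n"]) auto
qed

text \<open>The symmetric substrips in the definition are cofinal among all closed substrips:
  \<delta> is taken as the smaller distance of the given substrip to the two boundary lines.\<close>

lemma whittaker_solution_iff:
  "whittaker_solution l \<mu> F \<longleftrightarrow>
     whittaker_ode l \<mu> (horizontal_strip (- (3 * pi / 2)) (3 * pi / 2)) F \<and>
     tends_to_one (- (3 * pi / 2)) (3 * pi / 2) (whittaker_amplitude l F)"
proof -
  have strip: "horizontal_strip (- (3 * pi / 2)) (3 * pi / 2) = {\<zeta>. \<bar>Im \<zeta>\<bar> < 3 * pi / 2}"
    by (auto simp: horizontal_strip_def abs_less_iff)
  have lim: "(\<forall>\<delta>>0. (R \<longlongrightarrow> 1)
        (inf (filtercomap Re at_top) (principal {\<zeta>. \<bar>Im \<zeta>\<bar> \<le> 3 * pi / 2 - \<delta>})))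
      \<longleftrightarrow> tends_to_one (- (3 * pi / 2)) (3 * pi / 2) R" (is "?L \<longleftrightarrow> ?R") for R
  proof
    assume L: ?L
    show ?R unfolding tends_to_one_def
    proof (intro allI impI)
      fix \<alpha>' \<beta>' \<epsilon> :: real assume a: "- (3 * pi / 2) < \<alpha>'" "\<beta>' < 3 * pi / 2" "\<epsilon> > 0"
      define \<delta> where "\<delta> = min (\<alpha>' + 3 * pi / 2) (3 * pi / 2 - \<beta>')"
      have "\<delta> > 0" using a by (simp add: \<delta>_def)
      with L a obtain T where T: "\<And>\<zeta>. \<bar>Im \<zeta>\<bar> \<le> 3 * pi / 2 - \<delta> \<Longrightarrow> T \<le> Re \<zeta> \<Longrightarrow> norm (R \<zeta> - 1) < \<epsilon>"
        unfolding tendsto_right_end_iff by blast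
      show "\<exists>T. \<forall>\<zeta>. T \<le> Re \<zeta> \<and> \<alpha>' \<le> Im \<zeta> \<and> Im \<zeta> \<le> \<beta>' \<longrightarrow> norm (R \<zeta> - 1) < \<epsilon>"
        by (rule exI[of _ T]) (auto intro!: T simp: \<delta>_def)
    qed
  next
    assume R: ?R
    show ?L unfolding tendsto_right_end_iff
    proof (intro allI impI)
      fix \<delta> \<epsilon> :: real assume a: "\<delta> > 0" "\<epsilon> > 0"
      have 1: "- (3 * pi / 2) < - (3 * pi / 2 - \<delta>)" "3 * pi / 2 - \<delta> < 3 * pi / 2" using a by auto
      obtain T where "\<And>\<zeta>. T \<le> Re \<zeta> \<Longrightarrow> - (3 * pi / 2 - \<delta>) \<le> Im \<zeta> \<Longrightarrow> Im \<zeta> \<le> 3 * pi / 2 - \<delta>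
          \<Longrightarrow> norm (R \<zeta> - 1) < \<epsilon>"
        using R[unfolded tends_to_one_def, rule_format, OF 1 a(2)] by blast
      then show "\<exists>T. \<forall>\<zeta>\<in>{\<zeta>. \<bar>Im \<zeta>\<bar> \<le> 3 * pi / 2 - \<delta>}. T \<le> Re \<zeta> \<longrightarrow> norm (R \<zeta> - 1) < \<epsilon>"
        by (intro exI[of _ T]) (auto simp: abs_le_iff)
    qed
  qed
  show ?thesis
    using lim[of "whittaker_amplitude l F"]
    unfolding whittaker_solution_def whittaker_ode_def strip whittaker_amplitude_def[abs_def]
    by (simp only: mem_Collect_eq Ball_def conj_assoc)
qed

lemma tends_to_one_mono:
  "tends_to_one \<alpha> \<beta> R \<Longrightarrow> \<alpha> \<le> \<alpha>' \<Longrightarrow> \<beta>' \<le> \<beta> \<Longrightarrow> tends_to_one \<alpha>' \<beta>' R"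
  unfolding tends_to_one_def by (meson le_less_trans less_le_trans)

lemma whittaker_ode_subset:
  "whittaker_ode l \<mu> S F \<Longrightarrow> T \<subseteq> S \<Longrightarrow> whittaker_ode l \<mu> T F"
  unfolding whittaker_ode_def by (meson holomorphic_on_subset subsetD)

lemma tendsto_along_ray:
  assumes "tends_to_one \<alpha> \<beta> R" "\<alpha> < \<theta>" "\<theta> < \<beta>"
  shows "((\<lambda>t. R (Complex t \<theta>)) \<longlongrightarrow> 1) at_top"
  unfolding tendsto_iff eventually_at_top_linorder dist_norm
proof (intro allI impI)
  fix e :: real assume "e > 0"
  with assms obtain T where "\<And>\<zeta>. T \<le> Re \<zeta> \<Longrightarrow> \<theta> \<le> Im \<zeta> \<Longrightarrow> Im \<zeta> \<le> \<theta> \<Longrightarrow> norm (R \<zeta> - 1) < e"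
    unfolding tends_to_one_def by meson
  then show "\<exists>N. \<forall>n\<ge>N. cmod (R (Complex n \<theta>) - 1) < e" by (intro exI[of _ T]) auto
qed

text \<open>Cauchy's estimate on discs of fixed radius.\<close>

lemma deriv_tendsto_along_ray:
  assumes R: "tends_to_one \<alpha> \<beta> R" "\<alpha> < \<theta>" "\<theta> < \<beta>"
    and hol: "R holomorphic_on horizontal_strip \<alpha> \<beta>"
  shows "((\<lambda>t. deriv R (Complex t \<theta>)) \<longlongrightarrow> 0) at_top"
  unfolding tendsto_iff eventually_at_top_linorder dist_norm
proof (intro allI impI)
  fix e :: real assume e: "e > 0"
  define r where "r = min (\<theta> - \<alpha>) (\<beta> - \<theta>) / 2"
  have r: "r > 0" "\<alpha> < \<theta> - r" "\<theta> + r < \<beta>" using R by (auto simp: r_def min_def field_simps)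
  have "e * r / 2 > 0" using e r by simp
  from R(1)[unfolded tends_to_one_def, rule_format, OF r(2,3) this]
  obtain T where T: "\<And>\<zeta>. T \<le> Re \<zeta> \<Longrightarrow> \<theta> - r \<le> Im \<zeta> \<Longrightarrow> Im \<zeta> \<le> \<theta> + r
      \<Longrightarrow> norm (R \<zeta> - 1) < e * r / 2" by blast
  have "cmod (deriv R (Complex t \<theta>) - 0) < e" if t: "t \<ge> T + r" for t
  proof -
    let ?z = "Complex t \<theta>"
    have in_strip: "cball ?z r \<subseteq> horizontal_strip \<alpha> \<beta>"
    proof
      fix w assume "w \<in> cball ?z r"
      then have "\<bar>Im (w - ?z)\<bar> \<le> r" using abs_Im_le_cmod[of "w - ?z"] by (simp add: dist_norm norm_minus_commute)
      then show "w \<in> horizontal_strip \<alpha> \<beta>" using r by (auto simp: horizontal_strip_def)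
    qed
    have hol1: "(\<lambda>w. R w - 1) holomorphic_on cball ?z r"
      by (intro holomorphic_intros holomorphic_on_subset[OF hol in_strip])
    have "norm ((deriv ^^ 1) (\<lambda>w. R w - 1) ?z) \<le> fact 1 * (e * r / 2) / r ^ 1"
    proof (rule Cauchy_inequality)
      show "(\<lambda>w. R w - 1) holomorphic_on ball ?z r"
        using hol1 by (rule holomorphic_on_subset) auto
      show "continuous_on (cball ?z r) (\<lambda>w. R w - 1)"
        using hol1 by (rule holomorphic_on_imp_continuous_on)
      fix w assume "cmod (?z - w) = r"
      then have "\<bar>Im (?z - w)\<bar> \<le> r" "\<bar>Re (?z - w)\<bar> \<le> r"
        using abs_Im_le_cmod[of "?z - w"] abs_Re_le_cmod[of "?z - w"] by auto
      then show "cmod (R w - 1) \<le> e * r / 2"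
        using t unfolding abs_le_iff by (intro less_imp_le[OF T]) auto
    qed (use r in auto)
    moreover have "R field_differentiable at ?z"
      using hol horizontal_strip_open r
      by (metis holomorphic_on_imp_differentiable_at in_strip centre_in_cball less_imp_le subsetD)
    then have "deriv (\<lambda>w. R w - 1) ?z = deriv R ?z" by (simp add: deriv_diff)
    ultimately have "cmod (deriv R ?z) \<le> e / 2" using r by simp
    then show ?thesis using e by simp
  qed
  then show "\<exists>N. \<forall>t\<ge>N. cmod (deriv R (Complex t \<theta>) - 0) < e" by blast
qed

text \<open>The equation as a first-order system for F and dF/dz. The factor
  \<open>exp \<zeta>\<close> appears because d/d\<zeta> = z d/dz.\<close>

lemma z_deriv_eqs:
  assumes "whittaker_ode l \<mu> S F" "open S" "\<zeta> \<in> S"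
  shows "(F has_field_derivative z_deriv F \<zeta> * exp \<zeta>) (at \<zeta>)"
    and "(z_deriv F has_field_derivative
           (1 / 4 - l / exp \<zeta> - (1 / 4 - \<mu>\<^sup>2) / (exp \<zeta>)\<^sup>2) * F \<zeta> * exp \<zeta>) (at \<zeta>)"
proof -
  have hol: "F holomorphic_on S" using assms by (simp add: whittaker_ode_def)
  then show "(F has_field_derivative z_deriv F \<zeta> * exp \<zeta>) (at \<zeta>)"
    using assms by (simp add: z_deriv_def holomorphic_derivI)
  have "z_deriv F holomorphic_on S"
    unfolding z_deriv_def [abs_def] using assms hol
    by (intro holomorphic_intros holomorphic_deriv) auto
  then have "(z_deriv F has_field_derivative z_deriv (z_deriv F) \<zeta> * exp \<zeta>) (at \<zeta>)"
    using assms by (simp add: z_deriv_def[of "z_deriv F"] holomorphic_derivI)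
  moreover have "z_deriv (z_deriv F) \<zeta> = (1 / 4 - l / exp \<zeta> - (1 / 4 - \<mu>\<^sup>2) / (exp \<zeta>)\<^sup>2) * F \<zeta>"
  proof -
    have "z_deriv (z_deriv F) \<zeta>
        + (- 1 / 4 + l / exp \<zeta> + (1 / 4 - \<mu>\<^sup>2) / (exp \<zeta>)\<^sup>2) * F \<zeta> = 0"
      using assms by (simp add: whittaker_ode_def)
    then show ?thesis by (simp add: algebra_simps add_eq_0_iff)
  qed
  ultimately show "(z_deriv F has_field_derivative
           (1 / 4 - l / exp \<zeta> - (1 / 4 - \<mu>\<^sup>2) / (exp \<zeta>)\<^sup>2) * F \<zeta> * exp \<zeta>) (at \<zeta>)" by simp
qed

lemma whittaker_ode_cong:
  assumes "whittaker_ode l \<mu> S G" "open S" "\<And>\<zeta>. \<zeta> \<in> S \<Longrightarrow> F \<zeta> = G \<zeta>"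
  shows "whittaker_ode l \<mu> S F"
proof -
  have nh: "\<forall>\<^sub>F w in nhds \<zeta>. w \<in> S" if "\<zeta> \<in> S" for \<zeta> using that assms(2) by (simp add: eventually_nhds_in_open)
  have 1: "z_deriv F \<zeta> = z_deriv G \<zeta>" if "\<zeta> \<in> S" for \<zeta>
    unfolding z_deriv_def
    using deriv_cong_ev[OF eventually_mono[OF nh[OF that] assms(3)]] by simp
  have 2: "z_deriv (z_deriv F) \<zeta> = z_deriv (z_deriv G) \<zeta>" if "\<zeta> \<in> S" for \<zeta>
    unfolding z_deriv_def[of "z_deriv F"] z_deriv_def[of "z_deriv G"]
    using deriv_cong_ev[OF eventually_mono[OF nh[OF that] 1]] by simp
  have "F holomorphic_on S"
    using assms(1) holomorphic_transform[of G S F] assms(3) by (simp add: whittaker_ode_def)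
  then show ?thesis using assms 2 by (simp add: whittaker_ode_def)
qed

text \<open>Abel's identity: in the variable z the equation has no first-order term, so the
  Wronskian formed with d/dz, rather than d/d\<zeta>, is the constant one.\<close>

lemma z_wronskian_constant:
  assumes F: "whittaker_ode l \<mu> S F" "whittaker_ode l \<mu> S G" and S: "open S" "convex S"
  obtains c where "\<And>\<zeta>. \<zeta> \<in> S \<Longrightarrow> F \<zeta> * z_deriv G \<zeta> - G \<zeta> * z_deriv F \<zeta> = c"
proof -
  have "\<exists>c. \<forall>\<zeta>\<in>S. F \<zeta> * z_deriv G \<zeta> - G \<zeta> * z_deriv F \<zeta> = c"
  proof (rule has_field_derivative_zero_constant[OF S(2)])
    fix \<zeta> assume \<zeta>: "\<zeta> \<in> S"
    show "((\<lambda>\<zeta>. F \<zeta> * z_deriv G \<zeta> - G \<zeta> * z_deriv F \<zeta>) has_field_derivative 0) (at \<zeta> within S)"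
      by (rule has_field_derivative_at_within)
        (rule derivative_eq_intros z_deriv_eqs[OF F(1) S(1) \<zeta>] z_deriv_eqs[OF F(2) S(1) \<zeta>] refl
          | simp add: algebra_simps)+
  qed
  then show ?thesis using that by blast
qed

section \<open>Amplitudes and uniqueness of the recessive solution\<close>

lemma whittaker_amplitude_holomorphic:
  "F holomorphic_on S \<Longrightarrow> whittaker_amplitude l F holomorphic_on S"
  unfolding whittaker_amplitude_def[abs_def] by (intro holomorphic_intros) auto

lemma whittaker_amplitude_mult:
  "F \<zeta> = exp (- exp \<zeta> / 2) * exp (l * \<zeta>) * whittaker_amplitude l F \<zeta>"
  by (simp add: whittaker_amplitude_def)

text \<open>Product rule. Where the amplitude tends to 1 and its derivative to 0, this yields W'/W
  -> -1/2, the source of the phase limit of g'/g later.\<close>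

lemma z_deriv_amplitude:
  assumes "F holomorphic_on S" "open S" "\<zeta> \<in> S"
  shows "z_deriv F \<zeta> = exp (- exp \<zeta> / 2) * exp (l * \<zeta>) *
    ((l / exp \<zeta> - 1 / 2) * whittaker_amplitude l F \<zeta> + deriv (whittaker_amplitude l F) \<zeta> / exp \<zeta>)"
proof -
  let ?R = "whittaker_amplitude l F"
  have R: "(?R has_field_derivative deriv ?R \<zeta>) (at \<zeta>)"
    using whittaker_amplitude_holomorphic[OF assms(1)] assms(2,3) holomorphic_derivI by blast
  have "((\<lambda>\<zeta>. exp (- exp \<zeta> / 2) * exp (l * \<zeta>) * ?R \<zeta>) has_field_derivative
     exp (- exp \<zeta> / 2) * exp (l * \<zeta>) * ((l - exp \<zeta> / 2) * ?R \<zeta> + deriv ?R \<zeta>)) (at \<zeta>)"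
    by (rule derivative_eq_intros R refl | simp add: algebra_simps)+
  then have "(F has_field_derivative
     exp (- exp \<zeta> / 2) * exp (l * \<zeta>) * ((l - exp \<zeta> / 2) * ?R \<zeta> + deriv ?R \<zeta>)) (at \<zeta>)"
    by (simp add: whittaker_amplitude_def)
  then have "deriv F \<zeta> = exp (- exp \<zeta> / 2) * exp (l * \<zeta>) * ((l - exp \<zeta> / 2) * ?R \<zeta> + deriv ?R \<zeta>)"
    by (rule DERIV_imp_deriv)
  then show ?thesis by (simp add: z_deriv_def field_simps)
qed

text \<open>The shape is that of the real part of
  \<open>exp \<zeta> + \<zeta> - 2 * l * \<zeta>\<close> on the ray Im \<zeta> = \<theta>: for
  positive cosine the exponential beats the linear term, whatever l is.\<close>

lemma filterlim_ray_exponent: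
  assumes "cos \<theta> > 0"
  shows "filterlim (\<lambda>t::real. exp t * cos \<theta> + p * t + q) at_top at_top"
  using assms by real_asymp

text \<open>
  In terms of the amplitudes the Wronskian of two solutions is \<open>e\<^bsup>-z\<^esup> z\<^bsup>2\<lambda>-1\<^esup>\<close> times a quantity
  that tends to \<open>0\<close>; on a ray with \<open>Re z > 0\<close> it therefore vanishes, and the quotient of the
  solutions is constant.
\<close>

lemma whittaker_ode_unique:
  assumes F: "whittaker_ode l \<mu> (horizontal_strip \<alpha> \<beta>) F" "tends_to_one \<alpha> \<beta> (whittaker_amplitude l F)"
    and G: "whittaker_ode l \<mu> (horizontal_strip \<alpha> \<beta>) G" "tends_to_one \<alpha> \<beta> (whittaker_amplitude l G)"
    and \<theta>: "\<alpha> < \<theta>" "\<theta> < \<beta>" "\<bar>\<theta>\<bar> < pi / 2"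
    and \<zeta>: "\<zeta> \<in> horizontal_strip \<alpha> \<beta>"
  shows "F \<zeta> = G \<zeta>"
proof -
  let ?S = "horizontal_strip \<alpha> \<beta>"
  let ?RF = "whittaker_amplitude l F" and ?RG = "whittaker_amplitude l G"
  have hF: "F holomorphic_on ?S" and hG: "G holomorphic_on ?S" using F G by (auto simp: whittaker_ode_def)
  have hRF: "?RF holomorphic_on ?S" and hRG: "?RG holomorphic_on ?S"
    using hF hG by (auto intro: whittaker_amplitude_holomorphic)
  have ray: "Complex t \<theta> \<in> ?S" for t using \<theta> by (simp add: horizontal_strip_def)
  obtain c where c: "\<And>\<zeta>. \<zeta> \<in> ?S \<Longrightarrow> F \<zeta> * z_deriv G \<zeta> - G \<zeta> * z_deriv F \<zeta> = c"
    using z_wronskian_constant[OF F(1) G(1) horizontal_strip_open horizontal_strip_convex] by blast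
  define D where "D = (\<lambda>\<zeta>. ?RF \<zeta> * deriv ?RG \<zeta> - ?RG \<zeta> * deriv ?RF \<zeta>)"
  have D: "c * exp (exp \<zeta> + \<zeta> - 2 * l * \<zeta>) = D \<zeta>" if "\<zeta> \<in> ?S" for \<zeta>
  proof -
    let ?E = "exp (- exp \<zeta> / 2) * exp (l * \<zeta>)"
    have "c = ?E\<^sup>2 * D \<zeta> / exp \<zeta>"
      unfolding c[OF that, symmetric] z_deriv_amplitude[OF hF horizontal_strip_open that, of l]
        z_deriv_amplitude[OF hG horizontal_strip_open that, of l]
        whittaker_amplitude_mult[of F \<zeta> l] whittaker_amplitude_mult[of G \<zeta> l] D_def
      by (simp add: whittaker_amplitude_def field_simps power2_eq_square)
    moreover have "?E\<^sup>2 / exp \<zeta> * exp (exp \<zeta> + \<zeta> - 2 * l * \<zeta>) = 1"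
      by (simp add: power2_eq_square exp_diff[symmetric] exp_add[symmetric] algebra_simps)
    moreover have "?E\<^sup>2 * D \<zeta> / exp \<zeta> * X = D \<zeta> * (?E\<^sup>2 / exp \<zeta> * X)" for X by simp
    ultimately show ?thesis by (metis mult.right_neutral)
  qed
  have lims: "((\<lambda>t. ?RF (Complex t \<theta>)) \<longlongrightarrow> 1) at_top" "((\<lambda>t. ?RG (Complex t \<theta>)) \<longlongrightarrow> 1) at_top"
     "((\<lambda>t. deriv ?RF (Complex t \<theta>)) \<longlongrightarrow> 0) at_top" "((\<lambda>t. deriv ?RG (Complex t \<theta>)) \<longlongrightarrow> 0) at_top"
    using tendsto_along_ray[OF F(2) \<theta>(1,2)] tendsto_along_ray[OF G(2) \<theta>(1,2)]
     deriv_tendsto_along_ray[OF F(2) \<theta>(1,2) hRF] deriv_tendsto_along_ray[OF G(2) \<theta>(1,2) hRG] by auto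
  have "((\<lambda>t. D (Complex t \<theta>)) \<longlongrightarrow> 1 * 0 - 1 * 0) at_top"
    unfolding D_def by (intro tendsto_intros lims)
  then have Dlim: "((\<lambda>t. norm (D (Complex t \<theta>))) \<longlongrightarrow> 0) at_top"
    by (simp add: tendsto_norm_zero)
  have "c = 0"
  proof (rule ccontr)
    assume "c \<noteq> 0"
    have cos: "cos \<theta> > 0" using \<theta>(3) by (intro cos_gt_zero_pi) auto
    let ?h = "\<lambda>t. exp t * cos \<theta> + (1 - 2 * Re l) * t + 2 * Im l * \<theta>"
    have nD: "norm (D (Complex t \<theta>)) = norm c * exp (?h t)" for t
      unfolding D[OF ray, symmetric] norm_mult norm_exp_eq_Re by (simp add: Re_exp algebra_simps)
    have "filterlim (\<lambda>t. norm c * exp (?h t)) at_top at_top"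
      using \<open>c \<noteq> 0\<close>
      by (intro filterlim_tendsto_pos_mult_at_top[OF tendsto_const]
          filterlim_compose[OF exp_at_top filterlim_ray_exponent[OF cos]]) auto
    then have "filterlim (\<lambda>t. norm (D (Complex t \<theta>))) at_top at_top" by (simp add: nD)
    with Dlim show False
      using not_tendsto_and_filterlim_at_infinity[of at_top _ 0] filterlim_at_top_imp_at_infinity
      by (metis trivial_limit_at_top_linorder)
  qed
  then have D0: "D \<zeta> = 0" if "\<zeta> \<in> ?S" for \<zeta> using D[OF that] by simp
  \<comment> \<open>A closed substrip strictly around the ray is chosen, because far to the right in
    it the amplitude of F is within 1 of 1, hence nonzero. On that region the quotient of amplitudes
    is defined, and its derivative has numerator D = 0.\<close>
  define \<theta>1 where "\<theta>1 = (\<alpha> + \<theta>) / 2"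
  define \<theta>2 where "\<theta>2 = (\<theta> + \<beta>) / 2"
  have \<theta>12: "\<alpha> < \<theta>1" "\<theta>1 < \<theta>" "\<theta> < \<theta>2" "\<theta>2 < \<beta>" using \<theta> by (auto simp: \<theta>1_def \<theta>2_def)
  obtain T where T: "\<And>\<zeta>. T \<le> Re \<zeta> \<Longrightarrow> \<theta>1 \<le> Im \<zeta> \<Longrightarrow> Im \<zeta> \<le> \<theta>2 \<Longrightarrow> norm (?RF \<zeta> - 1) < 1"
    using F(2) \<theta>12 unfolding tends_to_one_def by (metis zero_less_one)
  define U where "U = {\<zeta>. T < Re \<zeta>} \<inter> horizontal_strip \<theta>1 \<theta>2"
  have U: "open U" "convex U"
    unfolding U_def by (intro open_Int convex_Int open_halfspace_Re_gt convex_halfspace_Re_gt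
        horizontal_strip_open horizontal_strip_convex)+
  have US: "U \<subseteq> ?S" using \<theta>12 by (auto simp: U_def horizontal_strip_def)
  have nz: "?RF \<zeta> \<noteq> 0" if "\<zeta> \<in> U" for \<zeta>
    using T[of \<zeta>] that by (auto simp: U_def horizontal_strip_def)
  have "\<exists>q. \<forall>\<zeta>\<in>U. ?RG \<zeta> / ?RF \<zeta> = q"
  proof (rule has_field_derivative_zero_constant[OF U(2)])
    fix \<zeta> assume \<zeta>: "\<zeta> \<in> U"
    then have "\<zeta> \<in> ?S" using US by auto
    then have der: "(?RF has_field_derivative deriv ?RF \<zeta>) (at \<zeta>)"
        "(?RG has_field_derivative deriv ?RG \<zeta>) (at \<zeta>)"
      using hRF hRG horizontal_strip_open holomorphic_derivI by blast+
    show "((\<lambda>\<zeta>. ?RG \<zeta> / ?RF \<zeta>) has_field_derivative 0) (at \<zeta> within U)"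
    proof (rule has_field_derivative_at_within)
      have "deriv ?RG \<zeta> * ?RF \<zeta> - ?RG \<zeta> * deriv ?RF \<zeta> = 0"
        using D0[OF \<open>\<zeta> \<in> ?S\<close>] by (simp add: D_def mult.commute)
      with DERIV_divide[OF der(2,1) nz[OF \<zeta>]]
      show "((\<lambda>\<zeta>. ?RG \<zeta> / ?RF \<zeta>) has_field_derivative 0) (at \<zeta>)" by (simp only: div_0)
    qed
  qed
  then obtain q where q: "\<And>\<zeta>. \<zeta> \<in> U \<Longrightarrow> ?RG \<zeta> / ?RF \<zeta> = q" by blast
  have "((\<lambda>t. ?RG (Complex t \<theta>) / ?RF (Complex t \<theta>)) \<longlongrightarrow> 1 / 1) at_top"
    by (intro tendsto_intros lims) auto
  moreover have "\<forall>\<^sub>F t in at_top. ?RG (Complex t \<theta>) / ?RF (Complex t \<theta>) = q"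
    using eventually_gt_at_top[of T] \<theta>12
    by (elim eventually_mono) (intro q, auto simp: U_def horizontal_strip_def)
  ultimately have "((\<lambda>_::real. q) \<longlongrightarrow> 1) at_top"
    using Lim_transform_eventually by fastforce
  then have "q = 1" by (simp add: tendsto_const_iff)
  have FG: "F \<zeta> = G \<zeta>" if "\<zeta> \<in> U" for \<zeta>
  proof -
    have "?RG \<zeta> = ?RF \<zeta>" using q[OF that] nz[OF that] \<open>q = 1\<close> by (simp add: field_simps)
    then show ?thesis using whittaker_amplitude_mult[of F \<zeta> l] whittaker_amplitude_mult[of G \<zeta> l] by simp
  qed
  \<comment> \<open>The region is nonempty and open, so equality there propagates to the whole strip
    by analytic continuation.\<close>
  have "Complex (T + 1) \<theta> \<in> U" using \<theta>12 by (simp add: U_def horizontal_strip_def)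
  then show ?thesis
    using analytic_continuation_open[OF U(1) horizontal_strip_open _
        convex_connected[OF horizontal_strip_convex] US hF hG FG \<zeta>] by blast
qed

section \<open>Laplace integrals\<close>

lemma set_integral_norm_le:
  fixes f :: "'a \<Rightarrow> 'b::{banach, second_countable_topology}"
  assumes "set_integrable M A f" "set_integrable M A g" "\<And>x. x \<in> A \<Longrightarrow> norm (f x) \<le> g x"
  shows "norm (LINT x:A|M. f x) \<le> (LINT x:A|M. g x)"
proof -
  have "norm (LINT x:A|M. f x) \<le> (LINT x:A|M. norm (f x))"
    using assms(1) by (rule set_integral_norm_bound)
  also have "\<dots> \<le> (LINT x:A|M. g x)"
    using assms by (intro set_integral_mono set_integrable_norm) auto
  finally show ?thesis .
qed

lemma integral_total_derivative_eq_0: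
  fixes F f :: "real \<Rightarrow> complex"
  assumes "\<And>s. s > 0 \<Longrightarrow> (F has_vector_derivative f s) (at s)" "continuous_on {0<..} f"
    "set_integrable lborel {0<..} f" "(F \<longlongrightarrow> 0) (at_right 0)" "(F \<longlongrightarrow> 0) at_top"
  shows "(LBINT s:{0<..}. f s) = 0"
proof -
  have "(LBINT s=ereal 0..\<infinity>. f s) = 0 - 0"
  proof (rule interval_integral_FTC_integrable)
    show "isCont f x" if "ereal 0 < ereal x" for x
      using that assms(2) continuous_on_eq_continuous_at[of "{0::real<..}" f] by auto
    show "((F \<circ> real_of_ereal) \<longlongrightarrow> 0) (at_right (ereal 0))"
      using assms(4) by (simp only: ereal_tendsto_simps1)
    show "((F \<circ> real_of_ereal) \<longlongrightarrow> 0) (at_left \<infinity>)"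
      using assms(5) by (simp only: ereal_tendsto_simps1)
  qed (use assms in auto)
  then show ?thesis unfolding interval_integral_to_infinity_eq by simp
qed

section \<open>Laplace transforms of weights dominated by a power\<close>

definition laplace :: "(real \<Rightarrow> complex) \<Rightarrow> complex \<Rightarrow> complex" where
  "laplace w Z = (LBINT s:{0<..}. exp (- Z * of_real s) * w s)"

text \<open>The shift makes p the argument of the Gamma function that dominates the transform.
  Integrability at 0 is then p > 0, and each factor s raises p by one with the same K.\<close>

definition power_bounded :: "real \<Rightarrow> real \<Rightarrow> (real \<Rightarrow> complex) \<Rightarrow> bool" where
  "power_bounded p K w \<longleftrightarrow> continuous_on {0<..} w \<and> (\<forall>s>0. norm (w s) \<le> K * s powr (p - 1))"

text \<open>The integrand is the norm of the complex Gamma integrand, whose integrability is known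
  for Lebesgue measure; Borel measurability transfers it to \<open>lborel\<close>.\<close>

lemma gamma_kernel_integrable:
  fixes p x :: real
  assumes "p > 0" "x > 0"
  shows "set_integrable lborel {0<..} (\<lambda>s. s powr (p - 1) * exp (- x * s))"
proof -
  let ?f = "\<lambda>s. indicator {0<..} s *\<^sub>R (s powr (p - 1) * exp (- x * s))"
  have "set_integrable lebesgue {0<..} (\<lambda>t. complex_of_real t powr (of_real p - 1) / of_real (exp (x * t)))"
    using absolutely_integrable_Gamma_integral[of "of_real p" x] assms by simp
  then have "integrable lebesgue (\<lambda>s. norm (indicator {0<..} s *\<^sub>R
      (complex_of_real s powr (of_real p - 1) / of_real (exp (x * s)))))"
    unfolding set_integrable_def by (rule integrable_norm)
  also have "(\<lambda>s. norm (indicator {0<..} s *\<^sub>R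
      (complex_of_real s powr (of_real p - 1) / of_real (exp (x * s))))) = ?f"
  proof
    fix s :: real
    show "norm (indicator {0<..} s *\<^sub>R
      (complex_of_real s powr (of_real p - 1) / of_real (exp (x * s)))) = ?f s"
    proof (cases "s > 0")
      case True
      then have "norm (complex_of_real s powr (of_real p - 1)) = s powr (p - 1)"
        by (subst norm_powr_real_powr) auto
      then show ?thesis using True by (simp add: norm_divide exp_minus field_simps)
    qed simp
  qed
  finally have "integrable (completion lborel) ?f" .
  moreover have "?f \<in> borel_measurable lborel" by measurable
  ultimately show ?thesis unfolding set_integrable_def by (simp add: integrable_completion)
qed

lemma power_bounded_integrable:
  assumes "power_bounded p K w" "p > 0" "Re Z > 0"
  shows "set_integrable lborel {0<..} (\<lambda>s. exp (- Z * of_real s) * w s)"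
proof (rule set_integrable_bound)
  show "set_integrable lborel {0<..} (\<lambda>s. K * (s powr (p - 1) * exp (- Re Z * s)))"
    using gamma_kernel_integrable[OF assms(2,3)] by simp
  have "continuous_on {0<..} (\<lambda>s. exp (- Z * of_real s) * w s)"
    using assms(1) by (auto simp: power_bounded_def intro!: continuous_intros)
  then show "set_borel_measurable lborel {0<..} (\<lambda>s. exp (- Z * of_real s) * w s)"
    unfolding set_borel_measurable_def
    using borel_measurable_continuous_on_indicator[of "{0<..}" "\<lambda>s. exp (- Z * of_real s) * w s"] by simp
  show "AE s in lborel. s \<in> {0<..} \<longrightarrow> norm (exp (- Z * of_real s) * w s)
      \<le> norm (K * (s powr (p - 1) * exp (- Re Z * s)))"
  proof (intro AE_I2 impI)
    fix s :: real assume "s \<in> {0<..}"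
    then have "norm (exp (- Z * of_real s) * w s) \<le> exp (- Re Z * s) * (K * s powr (p - 1))"
      using assms(1) by (simp add: norm_mult power_bounded_def mult_left_mono)
    also have "\<dots> \<le> norm (K * (s powr (p - 1) * exp (- Re Z * s)))" by (simp add: mult.left_commute mult.commute)
    finally show "norm (exp (- Z * of_real s) * w s) \<le> norm (K * (s powr (p - 1) * exp (- Re Z * s)))" .
  qed
qed

lemma laplace_norm_le:
  assumes "power_bounded p K w" "p > 0" "Re Z > 0"
  shows "norm (laplace w Z) \<le> K * (LBINT s:{0<..}. s powr (p - 1) * exp (- Re Z * s))"
proof -
  have "norm (laplace w Z) \<le> (LBINT s:{0<..}. K * (s powr (p - 1) * exp (- Re Z * s)))"
    unfolding laplace_def
  proof (rule set_integral_norm_le[OF power_bounded_integrable[OF assms]])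
    show "set_integrable lborel {0<..} (\<lambda>s. K * (s powr (p - 1) * exp (- Re Z * s)))"
      using gamma_kernel_integrable[OF assms(2,3)] by simp
    fix s :: real assume "s \<in> {0<..}"
    then show "norm (exp (- Z * of_real s) * w s) \<le> K * (s powr (p - 1) * exp (- Re Z * s))"
      using assms(1) mult_left_mono[of "norm (w s)" "K * s powr (p - 1)" "exp (- Re Z * s)"]
      by (simp add: norm_mult power_bounded_def mult.left_commute mult.commute)
  qed
  then show ?thesis by simp
qed

lemma power_bounded_mult_linear:
  assumes "power_bounded p K w"
  shows "power_bounded (p + 1) K (\<lambda>s. of_real s * w s)"
  unfolding power_bounded_def
proof (intro conjI allI impI)
  show "continuous_on {0<..} (\<lambda>s. of_real s * w s)"
    using assms by (auto simp: power_bounded_def intro!: continuous_intros)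
  fix s :: real assume s: "s > 0"
  have "norm (of_real s * w s) \<le> s * (K * s powr (p - 1))"
    using assms s by (simp add: norm_mult power_bounded_def)
  also have "\<dots> = K * s powr (p + 1 - 1)" using s powr_mult_base[of s "p - 1"] by (simp add: mult.left_commute)
  finally show "norm (of_real s * w s) \<le> K * s powr (p + 1 - 1)" .
qed

text \<open>Differentiation under the integral by an explicit remainder: the second-order Taylor
  estimate of \<open>exp\<close> bounds the error of the difference quotient by |Y - Z| times a
  fixed integral J.\<close>

lemma laplace_has_derivative:
  assumes w: "power_bounded p K w" "p > 0" and Z: "Re Z > 0"
  shows "(laplace w has_field_derivative - laplace (\<lambda>s. of_real s * w s) Z) (at Z)"
proof -
  \<comment> \<open>Half of the decay rate is reserved for the remainder: |h| < x costs at most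
    e^(xs), which leaves e^(-xs) of e^(-2xs). The exponent p + 2 in J accounts for the factor s^2 of
    the remainder.\<close>
  define x where "x = Re Z / 2"
  have x: "x > 0" using Z by (simp add: x_def)
  define J where "J = (LBINT s:{0<..}. K * (s powr (p + 2 - 1) * exp (- x * s)))"
  let ?w1 = "\<lambda>s. of_real s * w s"
  note w1 = power_bounded_mult_linear[OF w(1)]
  have "norm (w 1) \<le> K * 1 powr (p - 1)" using w(1) unfolding power_bounded_def by (meson zero_less_one)
  then have K: "K \<ge> 0" using order_trans[OF norm_ge_zero] by simp
  have est: "norm ((laplace w Y - laplace w Z) / (Y - Z) - (- laplace ?w1 Z)) \<le> norm (Y - Z) * J"
    if Y: "norm (Y - Z) < x" "Y \<noteq> Z" for Y
  proof -
    define h where "h = Y - Z"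
    have h: "h \<noteq> 0" "norm h < x" using Y by (auto simp: h_def)
    have "\<bar>Re h\<bar> < x" using abs_Re_le_cmod[of h] h by linarith
    then have ReY: "Re Y > 0" unfolding h_def x_def abs_less_iff using Z by (simp add: field_simps)
    have p1: "p + 1 > 0" using w by simp
    note int = power_bounded_integrable[OF w ReY] power_bounded_integrable[OF w Z]
      set_integrable_mult_right[of h, OF power_bounded_integrable[OF w1 p1 Z]]
    have intd: "set_integrable lborel {0<..} (\<lambda>s. exp (- Y * of_real s) * w s - exp (- Z * of_real s) * w s
          + h * (exp (- Z * of_real s) * ?w1 s))"
      using set_integral_add(1)[OF set_integral_diff(1)[OF int(1,2)] int(3)] .
    have "laplace w Y - laplace w Z + h * laplace ?w1 Z =
       (LBINT s:{0<..}. exp (- Y * of_real s) * w s - exp (- Z * of_real s) * w s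
          + h * (exp (- Z * of_real s) * ?w1 s))"
      unfolding set_integral_add(2)[OF set_integral_diff(1)[OF int(1,2)] int(3)]
        set_integral_diff(2)[OF int(1,2)] by (simp add: laplace_def)
    also have "norm \<dots> \<le> (LBINT s:{0<..}. (norm h)\<^sup>2 * (K * (s powr (p + 2 - 1) * exp (- x * s))))"
    proof (rule set_integral_norm_le[OF intd])
      show "set_integrable lborel {0<..} (\<lambda>s. (norm h)\<^sup>2 * (K * (s powr (p + 2 - 1) * exp (- x * s))))"
        using gamma_kernel_integrable[OF _ x, of "p + 2"] w by (intro set_integrable_mult_right) auto
      fix s :: real assume "s \<in> {0<..}"
      then have s: "s > 0" by simp
      have ws: "norm (w s) \<le> K * s powr (p - 1)" using w(1) s by (simp add: power_bounded_def)
      have eq: "exp (- Y * of_real s) * w s - exp (- Z * of_real s) * w s + h * (exp (- Z * of_real s) * ?w1 s)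
         = exp (- Z * of_real s) * w s * (exp (- h * of_real s) - (\<Sum>k\<le>1. (- h * of_real s) ^ k / fact k))"
      proof -
        have "exp (- Y * of_real s) = exp (- Z * of_real s) * exp (- h * of_real s)"
          by (simp add: h_def exp_add[symmetric] algebra_simps)
        then show ?thesis by (simp add: algebra_simps)
      qed
      have "norm (exp (- h * of_real s) - (\<Sum>k\<le>1. (- h * of_real s) ^ k / fact k))
          \<le> exp (norm (- h * of_real s)) * norm (- h * of_real s) ^ Suc 1 / fact 1"
        by (rule Taylor_exp_field)
      also have "\<dots> = exp (norm h * s) * ((norm h)\<^sup>2 * s\<^sup>2)"
        using s by (simp add: norm_mult power2_eq_square algebra_simps)
      also have "\<dots> \<le> exp (x * s) * ((norm h)\<^sup>2 * s\<^sup>2)"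
        using h s by (intro mult_right_mono) (auto intro!: mult_right_mono)
      finally have t: "norm (exp (- h * of_real s) - (\<Sum>k\<le>1. (- h * of_real s) ^ k / fact k))
          \<le> exp (x * s) * ((norm h)\<^sup>2 * s\<^sup>2)" .
      have "norm (exp (- Z * of_real s) * w s * (exp (- h * of_real s) - (\<Sum>k\<le>1. (- h * of_real s) ^ k / fact k)))
         \<le> exp (- 2 * x * s) * (K * s powr (p - 1)) * (exp (x * s) * ((norm h)\<^sup>2 * s\<^sup>2))"
        unfolding norm_mult by (intro mult_mono t ws) (use K in \<open>auto simp: x_def\<close>)
      also have "\<dots> = (norm h)\<^sup>2 * (K * ((s powr (p - 1) * s\<^sup>2) * (exp (- 2 * x * s) * exp (x * s))))"
        by (simp add: algebra_simps)
      also have "s powr (p - 1) * s\<^sup>2 = s powr (p + 2 - 1)"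
        using s powr_add[of s "p - 1" 2] by (simp add: algebra_simps)
      also have "exp (- 2 * x * s) * exp (x * s) = exp (- x * s)"
        by (simp add: exp_add[symmetric])
      finally show "norm (exp (- Y * of_real s) * w s - exp (- Z * of_real s) * w s
          + h * (exp (- Z * of_real s) * ?w1 s)) \<le> (norm h)\<^sup>2 * (K * (s powr (p + 2 - 1) * exp (- x * s)))"
        unfolding eq .
    qed
    also have "\<dots> = (norm h)\<^sup>2 * J" by (simp add: J_def)
    finally have "norm (laplace w Y - laplace w Z + h * laplace ?w1 Z) / norm h \<le> (norm h)\<^sup>2 * J / norm h"
      by (intro divide_right_mono) auto
    moreover have "(laplace w Y - laplace w Z) / h - (- laplace ?w1 Z)
        = (laplace w Y - laplace w Z + h * laplace ?w1 Z) / h" using h by (simp add: field_simps)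
    ultimately show ?thesis using h
      unfolding h_def[symmetric] by (simp add: norm_divide power2_eq_square)
  qed
  have "((\<lambda>Y. (laplace w Y - laplace w Z) / (Y - Z) - (- laplace ?w1 Z)) \<longlongrightarrow> 0) (at Z)"
  proof (rule Lim_null_comparison)
    show "\<forall>\<^sub>F Y in at Z. norm ((laplace w Y - laplace w Z) / (Y - Z) - (- laplace ?w1 Z)) \<le> norm (Y - Z) * J"
      unfolding eventually_at dist_norm using x est by blast
    have "((\<lambda>Y. norm (Y - Z) * J) \<longlongrightarrow> norm (Z - Z) * J) (at Z)"
      by (intro tendsto_intros)
    then show "((\<lambda>Y. norm (Y - Z) * J) \<longlongrightarrow> 0) (at Z)" by simp
  qed
  then have "((\<lambda>Y. (laplace w Y - laplace w Z) / (Y - Z)) \<longlongrightarrow> - laplace ?w1 Z) (at Z)"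
    by (rule LIM_zero_cancel)
  then show ?thesis by (simp add: has_field_derivative_iff)
qed

text \<open>The integrand u^(a-1) (1+u)^c of Tricomi's function U at u = s q, without the constant
  powers of q. Together with du = q ds these amount to q^a, which \<open>whittaker_ray\<close>
  carries as an exponential so that its branch is explicit.\<close>

definition kummer_kernel :: "complex \<Rightarrow> complex \<Rightarrow> complex \<Rightarrow> real \<Rightarrow> complex" where
  "kummer_kernel a c q s = of_real s powr (a - 1) * (1 + of_real s * q) powr c"

lemma continuous_on_kummer_kernel:
  assumes "\<And>s. s > 0 \<Longrightarrow> 1 + of_real s * q \<notin> \<real>\<^sub>\<le>\<^sub>0"
  shows "continuous_on {0<..} (kummer_kernel a c q)"
  unfolding kummer_kernel_def[abs_def]
proof (intro continuous_at_imp_continuous_on ballI continuous_mult)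
  fix s :: real assume "s \<in> {0<..}"
  then have s: "s > 0" by simp
  then have s': "complex_of_real s \<notin> \<real>\<^sub>\<le>\<^sub>0" by simp
  show "isCont (\<lambda>s. complex_of_real s powr (a - 1)) s"
    by (rule isCont_o2[where f = complex_of_real and g = "\<lambda>z. z powr (a - 1)"], intro continuous_intros)
      (rule DERIV_isCont[OF has_field_derivative_powr[OF s']])
  show "isCont (\<lambda>s. (1 + complex_of_real s * q) powr c) s"
    by (rule isCont_o2[where f = "\<lambda>s. 1 + complex_of_real s * q" and g = "\<lambda>z. z powr c"],
        intro continuous_intros)
      (rule DERIV_isCont[OF has_field_derivative_powr[OF assms[OF s]]])
qed

lemma norm_of_real_powr: "s > 0 \<Longrightarrow> norm (complex_of_real s powr z) = s powr Re z"
  by (subst norm_powr_real_powr) auto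

lemma power_bounded_kummer_kernel:
  assumes q: "\<And>s. s > 0 \<Longrightarrow> 1 + of_real s * q \<notin> \<real>\<^sub>\<le>\<^sub>0"
    "\<And>s. s > 0 \<Longrightarrow> norm ((1 + of_real s * q) powr c) \<le> K"
  shows "power_bounded (Re a) K (kummer_kernel a c q)"
  unfolding power_bounded_def
proof (intro conjI allI impI)
  show "continuous_on {0<..} (kummer_kernel a c q)" by (rule continuous_on_kummer_kernel[OF q(1)])
  fix s :: real assume s: "s > 0"
  show "norm (kummer_kernel a c q s) \<le> K * s powr (Re a - 1)"
    using s mult_right_mono[OF q(2)[OF s], of "s powr (Re a - 1)"]
    by (simp add: kummer_kernel_def norm_mult norm_of_real_powr mult.commute)
qed

text \<open>
  Integrates \<open>d/ds (e\<^bsup>-Zs\<^esup> s\<^bsup>a\<^esup> (1 + s q)\<^bsup>c+1\<^esup>)\<close>. With \<open>Z = z q\<close> this is Kummer's equation, and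
  \<open>q = 0\<close> gives the functional equation of the Gamma integral.
\<close>

lemma laplace_kummer_kernel_relation:
  fixes a c q Z :: complex
  assumes q: "\<And>s. s > 0 \<Longrightarrow> 1 + of_real s * q \<notin> \<real>\<^sub>\<le>\<^sub>0"
    "\<And>s. s > 0 \<Longrightarrow> norm ((1 + of_real s * q) powr c) \<le> K"
    and a: "Re a > 0" and Z: "Re Z > 0"
  defines "w \<equiv> kummer_kernel a c q"
  shows "Z * q * laplace (\<lambda>s. of_real s * (of_real s * w s)) Z + Z * laplace (\<lambda>s. of_real s * w s) Z
     - (a + c + 1) * q * laplace (\<lambda>s. of_real s * w s) Z - a * laplace w Z = 0"
proof -
  note w0 = power_bounded_kummer_kernel[OF q, of a, folded w_def]
  note w1 = power_bounded_mult_linear[OF w0]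
  note w2 = power_bounded_mult_linear[OF w1]
  have p: "Re a + 1 > 0" "Re a + 1 + 1 > 0" using a by auto
  note i0 = power_bounded_integrable[OF w0 a Z]
  note i1 = power_bounded_integrable[OF w1 p(1) Z]
  note i2 = power_bounded_integrable[OF w2 p(2) Z]
  let ?E = "\<lambda>s::real. exp (- Z * of_real s)"
  let ?f = "\<lambda>s. (- (Z * q)) * (?E s * (of_real s * (of_real s * w s)))
      + ((a + c + 1) * q - Z) * (?E s * (of_real s * w s)) + a * (?E s * w s)"
  let ?F = "\<lambda>s::real. ?E s * of_real s powr a * (1 + of_real s * q) powr (c + 1)"
  have j2: "set_integrable lborel {0<..} (\<lambda>s. - (Z * q) * (?E s * (of_real s * (of_real s * w s))))"
    by (intro set_integrable_mult_right i2)
  have j1: "set_integrable lborel {0<..} (\<lambda>s. ((a + c + 1) * q - Z) * (?E s * (of_real s * w s)))"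
    by (intro set_integrable_mult_right i1)
  have j0: "set_integrable lborel {0<..} (\<lambda>s. a * (?E s * w s))"
    by (intro set_integrable_mult_right i0)
  note j21 = set_integral_add(1)[OF j2 j1]
  have "(LBINT s:{0<..}. ?f s) = 0"
  proof (rule integral_total_derivative_eq_0)
    show "set_integrable lborel {0<..} ?f"
      by (rule set_integral_add(1)[OF j21 j0])
    show "continuous_on {0<..} ?f"
      using w0 by (auto simp: power_bounded_def intro!: continuous_intros)
    show "(?F has_vector_derivative ?f s) (at s)" if s: "s > 0" for s
    proof (rule has_vector_derivative_real_field)
      have s': "complex_of_real s \<notin> \<real>\<^sub>\<le>\<^sub>0" using s by simp
      have pow: "of_real s powr a = of_real s * of_real s powr (a - 1)"
        "(1 + of_real s * q) powr (c + 1) = (1 + of_real s * q) * (1 + of_real s * q) powr c"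
        using s q(1)[OF s] by (auto simp: powr_diff powr_add)
      have "((\<lambda>z. (1 + z * q) powr (c + 1)) has_field_derivative
          ((c + 1) * (1 + of_real s * q) powr (c + 1 - 1)) * q) (at (of_real s))"
        by (rule DERIV_chain2[where f = "\<lambda>z. z powr (c + 1)"], rule has_field_derivative_powr[OF q(1)[OF s]])
          (rule derivative_eq_intros refl | simp)+
      moreover have "((\<lambda>z. exp (- Z * z)) has_field_derivative - Z * exp (- Z * of_real s)) (at (of_real s))"
        by (rule derivative_eq_intros refl | simp)+
      ultimately have D: "((\<lambda>z. exp (- Z * z) * z powr a * (1 + z * q) powr (c + 1)) has_field_derivative
          (- Z * exp (- Z * of_real s) * of_real s powr a
            + a * of_real s powr (a - 1) * exp (- Z * of_real s)) * (1 + of_real s * q) powr (c + 1)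
          + (c + 1) * (1 + of_real s * q) powr (c + 1 - 1) * q * (exp (- Z * of_real s) * of_real s powr a))
          (at (of_real s))"
        by (intro DERIV_mult has_field_derivative_powr[OF s'])
      show "((\<lambda>z. exp (- Z * z) * z powr a * (1 + z * q) powr (c + 1)) has_field_derivative ?f s)
         (at (of_real s))"
        by (rule DERIV_cong[OF D], unfold w_def kummer_kernel_def pow) (simp add: algebra_simps)
    qed
    \<comment> \<open>The boundary terms vanish by this bound: the extra factor 1 + s q costs only
      linear growth, s^(Re a) tends to 0 at the origin, and the exponential wins at
      infinity.\<close>
    have bound: "norm (?F s) \<le> exp (- Re Z * s) * s powr Re a * (K * (1 + s * norm q))" if s: "s > 0" for s
    proof -
      have "norm ((1 + of_real s * q) powr (c + 1)) = norm ((1 + of_real s * q) powr c) * norm (1 + of_real s * q)"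
        using q(1)[OF s] by (auto simp: powr_add norm_mult)
      also have "\<dots> \<le> K * (1 + s * norm q)"
        using q(2)[OF s] s norm_triangle_ineq[of 1 "of_real s * q"] order_trans[OF norm_ge_zero q(2)[OF s]]
        by (intro mult_mono) (auto simp: norm_mult)
      finally show ?thesis using s by (simp add: norm_mult norm_of_real_powr mult_left_mono)
    qed
    have ev: "\<forall>\<^sub>F s in at_right 0. norm (?F s) \<le> exp (- Re Z * s) * s powr Re a * (K * (1 + s * norm q))"
      using eventually_at_right_less[of 0] by (rule eventually_mono) (rule bound)
    have ev': "\<forall>\<^sub>F s in at_top. norm (?F s) \<le> exp (- Re Z * s) * s powr Re a * (K * (1 + s * norm q))"
      using eventually_gt_at_top[of 0] by (rule eventually_mono) (rule bound)
    show "(?F \<longlongrightarrow> 0) (at_right 0)"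
      by (rule Lim_null_comparison[OF ev]) (use a Z in real_asymp)
    show "(?F \<longlongrightarrow> 0) at_top"
      by (rule Lim_null_comparison[OF ev']) (use a Z in real_asymp)
  qed
  moreover have "(LBINT s:{0<..}. ?f s) = - (Z * q) * laplace (\<lambda>s. of_real s * (of_real s * w s)) Z
      + ((a + c + 1) * q - Z) * laplace (\<lambda>s. of_real s * w s) Z + a * laplace w Z"
    using set_integral_add(2)[OF j21 j0] set_integral_add(2)[OF j2 j1]
    by (simp only: set_integral_mult_right laplace_def)
  ultimately show ?thesis by (simp add: algebra_simps)
qed

text \<open>The case q = 0 of the preceding relation says that Z^a times the transform has
  derivative zero on the right half-plane. The constant is read off at Z = 1 from Euler's integral,
  so no contour is rotated.\<close>

lemma laplace_power:
  assumes a: "Re a > 0" and Z: "Re Z > 0"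
  shows "laplace (\<lambda>s. of_real s powr (a - 1)) Z = Gamma a * Z powr (- a)"
proof -
  let ?w = "\<lambda>s::real. complex_of_real s powr (a - 1)"
  have w: "kummer_kernel a 0 0 = ?w" by (simp add: kummer_kernel_def[abs_def])
  have pb: "power_bounded (Re a) 1 ?w"
    using power_bounded_kummer_kernel[of 0 0 1 a] by (simp add: w)
  have "\<exists>k. \<forall>Z\<in>{Z. Re Z > 0}. Z powr a * laplace ?w Z = k"
  proof (rule has_field_derivative_zero_constant[OF convex_halfspace_Re_gt])
    fix Z :: complex assume "Z \<in> {Z. Re Z > 0}"
    then have Z: "Re Z > 0" by simp
    then have Z': "Z \<notin> \<real>\<^sub>\<le>\<^sub>0" "Z \<noteq> 0" by (auto simp: complex_nonpos_Reals_iff)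
    have rel: "Z * laplace (\<lambda>s. of_real s * ?w s) Z = a * laplace ?w Z"
      using laplace_kummer_kernel_relation[of 0 0 1 a Z] a Z by (simp add: w)
    have "((\<lambda>Z. Z powr a * laplace ?w Z) has_field_derivative
       a * Z powr (a - 1) * laplace ?w Z + - laplace (\<lambda>s. of_real s * ?w s) Z * Z powr a) (at Z)"
      by (rule DERIV_mult[OF has_field_derivative_powr[OF Z'(1)] laplace_has_derivative[OF pb a Z]])
    also have "a * Z powr (a - 1) * laplace ?w Z + - laplace (\<lambda>s. of_real s * ?w s) Z * Z powr a
      = Z powr (a - 1) * (a * laplace ?w Z - Z * laplace (\<lambda>s. of_real s * ?w s) Z)"
      using Z' by (simp add: powr_diff field_simps)
    also have "\<dots> = 0" by (simp only: rel diff_self mult_zero_right)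
    finally show "((\<lambda>Z. Z powr a * laplace ?w Z) has_field_derivative 0) (at Z within {Z. Re Z > 0})"
      by (rule has_field_derivative_at_within)
  qed
  then obtain k where k: "\<And>Z. Re Z > 0 \<Longrightarrow> Z powr a * laplace ?w Z = k" by auto
  have "laplace ?w 1 = (LBINT s:{0<..}. ?w s / of_real (exp s))"
    unfolding laplace_def by (intro set_lebesgue_integral_cong)
      (auto simp: exp_minus exp_of_real field_simps)
  also have "\<dots> = (LINT s:{0<..}|lebesgue. ?w s / of_real (exp s))"
    unfolding set_lebesgue_integral_def by (subst integral_completion) auto
  also have "\<dots> = Gamma a"
    using set_lebesgue_integral_eq_integral(2)[OF absolutely_integrable_Gamma_integral'[OF a]]
      Gamma_integral_complex'[OF a] by (simp add: integral_unique)
  finally have "k = Gamma a" using k[of 1] by simp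
  then have "Z powr a * laplace ?w Z = Gamma a" using k[OF Z] by simp
  moreover have "Z \<noteq> 0" using Z by auto
  ultimately show ?thesis by (simp add: powr_minus field_simps)
qed

lemma gamma_kernel_integral:
  fixes p x :: real
  assumes "p > 0" "x > 0"
  shows "(LBINT s:{0<..}. s powr (p - 1) * exp (- x * s)) = Gamma p * x powr (- p)"
proof -
  have "complex_of_real (LBINT s:{0<..}. s powr (p - 1) * exp (- x * s))
      = (LBINT s:{0<..}. complex_of_real (s powr (p - 1) * exp (- x * s)))"
    by (rule set_integral_complex_of_real[symmetric])
  also have "\<dots> = laplace (\<lambda>s. of_real s powr (of_real p - 1)) (of_real x)"
    unfolding laplace_def
  proof (intro set_lebesgue_integral_cong allI impI)
    fix s :: real assume "s \<in> {0<..}"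
    then show "complex_of_real (s powr (p - 1) * exp (- x * s))
        = exp (- complex_of_real x * of_real s) * of_real s powr (of_real p - 1)"
      using powr_of_real[of s "p - 1"] exp_of_real[of "- x * s", where 'a = complex] by (simp add: mult.commute)
  qed simp
  also have "\<dots> = of_real (Gamma p * x powr (- p))"
    using laplace_power[of "of_real p" "of_real x"] powr_of_real[of x "- p"] assms
    by (simp add: Gamma_complex_of_real)
  finally show ?thesis using of_real_eq_iff by blast
qed

section \<open>Existence of the Whittaker function\<close>

text \<open>Keeps 1 + u off the branch cut of the principal power along the whole ray of
  integration.\<close>

lemma one_plus_ray_not_nonpos:
  assumes "\<bar>\<phi>\<bar> < pi" "s \<ge> 0"
  shows "1 + complex_of_real s * cis \<phi> \<notin> \<real>\<^sub>\<le>\<^sub>0"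
proof
  assume "1 + complex_of_real s * cis \<phi> \<in> \<real>\<^sub>\<le>\<^sub>0"
  then have re: "1 + s * cos \<phi> \<le> 0" and im: "s * sin \<phi> = 0"
    by (auto simp: complex_nonpos_Reals_iff)
  from re have "s \<noteq> 0" by auto
  with im have "sin \<phi> = 0" by simp
  then have "\<phi> = 0" using sin_zero_pi_iff[of \<phi>] assms by simp
  then show False using re assms by simp
qed

text \<open>The squared norm is 1 + 2 s cos \<phi> + s^2. For negative cosine, 2 s <= 1 + s^2 turns
  it into at least (1 + s^2)(1 + cos \<phi>). The bound depends on \<Phi> only, as it must be
  uniform over the rays that are glued.\<close>

lemma norm_one_plus_ray_ge:
  assumes "\<bar>\<phi>\<bar> \<le> \<Phi>" "\<Phi> < pi" "s \<ge> 0"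
  shows "sqrt (min 1 (1 + cos \<Phi>)) \<le> norm (1 + complex_of_real s * cis \<phi>)"
proof -
  have "cos \<Phi> \<le> cos \<bar>\<phi>\<bar>" using assms by (intro cos_monotone_0_pi_le) auto
  then have c: "cos \<Phi> \<le> cos \<phi>" by simp
  have "(norm (1 + complex_of_real s * cis \<phi>))\<^sup>2 = (1 + s * cos \<phi>)\<^sup>2 + (s * sin \<phi>)\<^sup>2"
    by (simp add: cmod_power2)
  also have "\<dots> = 1 + 2 * s * cos \<phi> + s\<^sup>2 * ((cos \<phi>)\<^sup>2 + (sin \<phi>)\<^sup>2)"
    by algebra
  also have "\<dots> = 1 + 2 * s * cos \<phi> + s\<^sup>2" by simp
  also have "\<dots> \<ge> min 1 (1 + cos \<Phi>)"
  proof (cases "cos \<phi> \<ge> 0")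
    case True
    then have "s * cos \<phi> \<ge> 0" using assms by simp
    then show ?thesis by (intro min.coboundedI1) (simp add: mult.assoc)
  next
    case False
    have "2 * s \<le> 1 + s\<^sup>2" using sum_squares_bound[of s 1] by (simp add: power2_eq_square)
    then have "(1 + s\<^sup>2) * cos \<phi> \<le> (2 * s) * cos \<phi>" using False by (intro mult_right_mono_neg) auto
    moreover have "1 * (1 + cos \<phi>) \<le> (1 + s\<^sup>2) * (1 + cos \<phi>)"
    proof (rule mult_right_mono)
      show "0 \<le> 1 + cos \<phi>" using cos_ge_minus_one[of \<phi>] by linarith
    qed simp
    ultimately have "1 + cos \<phi> \<le> 1 + 2 * s * cos \<phi> + s\<^sup>2" by (simp add: algebra_simps)
    then show ?thesis using c by (intro min.coboundedI2) simp
  qed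
  finally show ?thesis by (rule real_le_lsqrt[OF norm_ge_zero])
qed

text \<open>|w^c| is |w|^(Re c) times e^(- Im c Arg w). Since Re c <= 0, the lower bound on |w|
  controls the first factor; |Arg w| <= pi controls the second.\<close>

lemma one_plus_ray_powr_bounded:
  assumes "0 \<le> \<Phi>" "\<Phi> < pi" "Re c \<le> 0"
  obtains K where "\<And>\<phi> s. \<bar>\<phi>\<bar> \<le> \<Phi> \<Longrightarrow> s \<ge> 0 \<Longrightarrow> norm ((1 + complex_of_real s * cis \<phi>) powr c) \<le> K"
proof
  fix \<phi> s :: real assume a: "\<bar>\<phi>\<bar> \<le> \<Phi>" "s \<ge> 0"
  let ?w = "1 + complex_of_real s * cis \<phi>" and ?d = "sqrt (min 1 (1 + cos \<Phi>))"
  have "cos pi < cos \<Phi>" using assms by (intro cos_monotone_0_pi) auto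
  then have d: "?d > 0" by simp
  have "norm ?w powr Re c \<le> ?d powr Re c"
    using norm_one_plus_ray_ge[OF a(1) assms(2) a(2)] d assms(3) by (intro powr_mono2') auto
  moreover have "- Im c * Arg ?w \<le> \<bar>Im c\<bar> * pi"
  proof -
    have "- Im c * Arg ?w \<le> \<bar>Im c\<bar> * \<bar>Arg ?w\<bar>" by (metis abs_ge_self abs_minus_cancel abs_mult)
    also have "\<dots> \<le> \<bar>Im c\<bar> * pi" using Arg_bounded[of ?w] by (intro mult_left_mono) auto
    finally show ?thesis .
  qed
  ultimately show "norm (?w powr c) \<le> ?d powr Re c * exp (\<bar>Im c\<bar> * pi)"
    unfolding norm_powr_complex by (intro mult_mono) auto
qed

text \<open>Mean value estimate on the segment from 0 to u, using that (1+u)^(c-1) is bounded as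
  well. The additional factor s supplies the 1/z by which the error in the asymptotics is
  small.\<close>

lemma one_plus_ray_powr_minus_one:
  assumes "0 \<le> \<Phi>" "\<Phi> < pi" "Re c \<le> 0"
  obtains K where "\<And>\<phi> s. \<bar>\<phi>\<bar> \<le> \<Phi> \<Longrightarrow> s \<ge> 0 \<Longrightarrow> norm ((1 + complex_of_real s * cis \<phi>) powr c - 1) \<le> K * s"
proof -
  obtain K where K: "\<And>\<phi> s. \<bar>\<phi>\<bar> \<le> \<Phi> \<Longrightarrow> s \<ge> 0 \<Longrightarrow> norm ((1 + complex_of_real s * cis \<phi>) powr (c - 1)) \<le> K"
    using one_plus_ray_powr_bounded[OF assms(1,2), of "c - 1"] assms(3) by auto
  show ?thesis
  proof
    fix \<phi> s :: real assume a: "\<bar>\<phi>\<bar> \<le> \<Phi>" "s \<ge> 0"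
    let ?u = "complex_of_real s * cis \<phi>"
    have seg: "\<exists>t\<ge>0. z = complex_of_real t * cis \<phi>" if "z \<in> closed_segment 0 ?u" for z
    proof -
      obtain v where "0 \<le> v" "z = complex_of_real (v * s) * cis \<phi>"
        using \<open>z \<in> closed_segment 0 ?u\<close> by (auto simp: in_segment scaleR_conv_of_real)
      then show ?thesis using a(2) by (intro exI[of _ "v * s"]) simp
    qed
    have "norm ((1 + ?u) powr c - (1 + 0) powr c) \<le> (norm c * K) * norm (?u - 0)"
    proof (rule field_differentiable_bound[where S = "closed_segment 0 ?u" and f = "\<lambda>z. (1 + z) powr c"
          and f' = "\<lambda>z. c * (1 + z) powr (c - 1)"])
      fix z assume "z \<in> closed_segment 0 ?u"
      then obtain t where t: "t \<ge> 0" "z = complex_of_real t * cis \<phi>" using seg by blast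
      have "1 + z \<notin> \<real>\<^sub>\<le>\<^sub>0" using one_plus_ray_not_nonpos[of \<phi> t] a t assms by simp
      then have "((\<lambda>z. (1 + z) powr c) has_field_derivative c * (1 + z) powr (c - 1) * 1) (at z)"
        by (intro DERIV_chain2[where f = "\<lambda>z. z powr c"] has_field_derivative_powr)
          (rule derivative_eq_intros refl | simp)+
      then show "((\<lambda>z. (1 + z) powr c) has_field_derivative c * (1 + z) powr (c - 1)) (at z within closed_segment 0 ?u)"
        by (simp add: has_field_derivative_at_within)
      show "norm (c * (1 + z) powr (c - 1)) \<le> norm c * K"
        using K[OF a(1) t(1)] t(2) by (simp add: norm_mult mult_left_mono)
    qed auto
    then show "norm ((1 + complex_of_real s * cis \<phi>) powr c - 1) \<le> (norm c * K) * s"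
      using a by (simp add: norm_mult)
  qed
qed

text \<open>
  The Whittaker function on the sheet \<open>\<bar>arg z + \<phi>\<bar> < \<pi>/2\<close>: the Laplace integral
  \<open>e\<^bsup>-z/2\<^esup> z\<^bsup>\<mu>+1/2\<^esup> / \<Gamma>(a) \<integral> e\<^bsup>-zu\<^esup> u\<^bsup>a-1\<^esup> (1+u)\<^bsup>c\<^esup> du\<close>, \<open>a = \<mu> - \<lambda> + 1/2\<close>, \<open>c = \<mu> + \<lambda> - 1/2\<close>,
  along the ray \<open>u = s e\<^bsup>i\<phi>\<^esup>\<close>.
\<close>

definition whittaker_ray :: "complex \<Rightarrow> complex \<Rightarrow> real \<Rightarrow> complex \<Rightarrow> complex" where
  "whittaker_ray l \<mu> \<phi> \<zeta> =
     exp (- exp \<zeta> / 2 + (\<mu> + 1 / 2) * \<zeta> + (\<mu> - l + 1 / 2) * (\<i> * of_real \<phi>)) / Gamma (\<mu> - l + 1 / 2)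
     * laplace (kummer_kernel (\<mu> - l + 1 / 2) (\<mu> + l - 1 / 2) (cis \<phi>)) (exp (\<zeta> + \<i> * of_real \<phi>))"

section \<open>The integral along one fixed ray: equation and asymptotics\<close>

lemma whittaker_odeI:
  assumes S: "open S"
    and F: "\<And>\<zeta>. \<zeta> \<in> S \<Longrightarrow> (F has_field_derivative F1 \<zeta> * exp \<zeta>) (at \<zeta>)"
    and F1: "\<And>\<zeta>. \<zeta> \<in> S \<Longrightarrow> (F1 has_field_derivative F2 \<zeta> * exp \<zeta>) (at \<zeta>)"
    and eq: "\<And>\<zeta>. \<zeta> \<in> S \<Longrightarrow>
      F2 \<zeta> + (- 1 / 4 + l / exp \<zeta> + (1 / 4 - \<mu>\<^sup>2) / (exp \<zeta>)\<^sup>2) * F \<zeta> = 0"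
  shows "whittaker_ode l \<mu> S F"
proof -
  have 1: "z_deriv F \<zeta> = F1 \<zeta>" if "\<zeta> \<in> S" for \<zeta>
    using DERIV_imp_deriv[OF F[OF that]] by (simp add: z_deriv_def)
  have "z_deriv (z_deriv F) \<zeta> = F2 \<zeta>" if "\<zeta> \<in> S" for \<zeta>
  proof -
    have "deriv (z_deriv F) \<zeta> = deriv F1 \<zeta>"
      using eventually_mono[OF eventually_nhds_in_open[OF S that] 1] by (intro deriv_cong_ev) auto
    then show ?thesis using DERIV_imp_deriv[OF F1[OF that]] by (simp add: z_deriv_def[of "z_deriv F"])
  qed
  moreover have "F holomorphic_on S"
    using F S by (auto simp: holomorphic_on_open)
  ultimately show ?thesis using eq by (simp add: whittaker_ode_def)
qed

lemma Re_exp_pos: "\<bar>Im Y\<bar> < pi / 2 \<Longrightarrow> Re (exp Y) > 0"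
  by (auto simp: Re_exp intro!: mult_pos_pos cos_gt_zero_pi)

text \<open>Differentiating the prefactor times the Laplace transform at Z = z q reduces Whittaker's
  equation to Kummer's: multiplied by z^2, its left side divided by the prefactor is z times the
  integrated relation between the transforms of w, s w and s^2 w.\<close>

lemma whittaker_ray_ode:
  assumes \<phi>: "\<bar>\<phi>\<bar> < pi" and a: "Re (\<mu> - l + 1 / 2) > 0" and c: "Re (\<mu> + l - 1 / 2) \<le> 0"
  shows "whittaker_ode l \<mu> (horizontal_strip (- \<phi> - pi / 2) (- \<phi> + pi / 2)) (whittaker_ray l \<mu> \<phi>)"
proof -
  define A where "A = \<mu> - l + 1 / 2"
  define C where "C = \<mu> + l - 1 / 2"
  define q where "q = cis \<phi>"
  define w where "w = kummer_kernel A C q"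
  define L0 where "L0 = laplace w"
  define L1 where "L1 = laplace (\<lambda>s. of_real s * w s)"
  define L2 where "L2 = laplace (\<lambda>s. of_real s * (of_real s * w s))"
  define Z where "Z = (\<lambda>\<zeta>. exp (\<zeta> + \<i> * of_real \<phi>))"
  define P where "P = (\<lambda>\<zeta>. exp (- exp \<zeta> / 2 + (\<mu> + 1 / 2) * \<zeta> + A * (\<i> * of_real \<phi>)) / Gamma A)"
  \<comment> \<open>This is P'/P with respect to z. Since L0' = - L1, L1' = - L2 and dZ/dz = q, the
    functions F1 and F2 below are the first and second z-derivatives of P times L0.\<close>
  let ?b = "\<lambda>\<zeta>. - 1 / 2 + (\<mu> + 1 / 2) / exp \<zeta>"
  define F1 where "F1 = (\<lambda>\<zeta>. P \<zeta> * (?b \<zeta> * L0 (Z \<zeta>) - q * L1 (Z \<zeta>)))"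
  define F2 where "F2 = (\<lambda>\<zeta>. P \<zeta> * (?b \<zeta> * (?b \<zeta> * L0 (Z \<zeta>) - q * L1 (Z \<zeta>))
     + (- ((\<mu> + 1 / 2) / (exp \<zeta>)\<^sup>2) * L0 (Z \<zeta>) - ?b \<zeta> * q * L1 (Z \<zeta>) + q\<^sup>2 * L2 (Z \<zeta>))))"
  obtain K where "\<And>\<psi> s. \<bar>\<psi>\<bar> \<le> \<bar>\<phi>\<bar> \<Longrightarrow> s \<ge> 0 \<Longrightarrow> norm ((1 + complex_of_real s * cis \<psi>) powr C) \<le> K"
    using one_plus_ray_powr_bounded[OF abs_ge_zero \<phi> c[folded C_def]] by blast
  then have K: "\<And>s. s \<ge> 0 \<Longrightarrow> norm ((1 + complex_of_real s * q) powr C) \<le> K"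
    by (simp add: q_def)
  have nonpos: "1 + complex_of_real s * q \<notin> \<real>\<^sub>\<le>\<^sub>0" if "s \<ge> 0" for s
    using one_plus_ray_not_nonpos[OF \<phi> that] by (simp add: q_def)
  have a': "Re A > 0" "Re A + 1 > 0" using a by (auto simp: A_def)
  have w0: "power_bounded (Re A) K w"
    unfolding w_def using nonpos K by (intro power_bounded_kummer_kernel) auto
  have Zq: "Z \<zeta> = exp \<zeta> * q" for \<zeta> by (simp add: Z_def q_def exp_add cis_conv_exp)
  have dZ: "(Z has_field_derivative Z \<zeta>) (at \<zeta>)" for \<zeta>
    unfolding Z_def by (rule derivative_eq_intros refl | simp)+
  have dP: "(P has_field_derivative P \<zeta> * ?b \<zeta> * exp \<zeta>) (at \<zeta>)" for \<zeta>
  proof -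
    have "((\<lambda>\<zeta>. exp (- exp \<zeta> / 2 + (\<mu> + 1 / 2) * \<zeta> + A * (\<i> * of_real \<phi>))) has_field_derivative
        exp (- exp \<zeta> / 2 + (\<mu> + 1 / 2) * \<zeta> + A * (\<i> * of_real \<phi>)) * (?b \<zeta> * exp \<zeta>)) (at \<zeta>)"
      by (rule derivative_eq_intros refl | simp add: field_simps)+
    from DERIV_cdivide[OF this, of "Gamma A"] show ?thesis
      unfolding P_def by (simp only: times_divide_eq_left mult.assoc)
  qed
  have db: "(?b has_field_derivative - ((\<mu> + 1 / 2) / exp \<zeta>)) (at \<zeta>)" for \<zeta>
    by (rule derivative_eq_intros refl | simp add: field_simps power2_eq_square)+
  show ?thesis
  proof (rule whittaker_odeI[OF horizontal_strip_open])
    fix \<zeta> assume "\<zeta> \<in> horizontal_strip (- \<phi> - pi / 2) (- \<phi> + pi / 2)"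
    then have ReZ: "Re (Z \<zeta>) > 0" unfolding Z_def
      by (intro Re_exp_pos, unfold abs_less_iff) (auto simp: horizontal_strip_def)
    have dL0: "((\<lambda>\<zeta>. L0 (Z \<zeta>)) has_field_derivative - L1 (Z \<zeta>) * Z \<zeta>) (at \<zeta>)"
      unfolding L0_def L1_def by (rule DERIV_chain2[OF laplace_has_derivative[OF w0 a'(1) ReZ] dZ])
    have dL1: "((\<lambda>\<zeta>. L1 (Z \<zeta>)) has_field_derivative - L2 (Z \<zeta>) * Z \<zeta>) (at \<zeta>)"
      unfolding L2_def L1_def
      by (rule DERIV_chain2[OF laplace_has_derivative[OF power_bounded_mult_linear[OF w0] a'(2) ReZ] dZ])
    have "((\<lambda>\<zeta>. P \<zeta> * L0 (Z \<zeta>)) has_field_derivative F1 \<zeta> * exp \<zeta>) (at \<zeta>)"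
      by (rule DERIV_cong[OF DERIV_mult[OF dP dL0]]) (simp add: F1_def Zq algebra_simps)
    then show "(whittaker_ray l \<mu> \<phi> has_field_derivative F1 \<zeta> * exp \<zeta>) (at \<zeta>)"
      by (simp add: whittaker_ray_def[abs_def] P_def L0_def w_def A_def C_def q_def Z_def)
    show "(F1 has_field_derivative F2 \<zeta> * exp \<zeta>) (at \<zeta>)"
      unfolding F1_def
      by (rule DERIV_cong[OF DERIV_mult[OF dP DERIV_diff[OF DERIV_mult[OF db dL0] DERIV_cmult[OF dL1]]]])
        (simp add: F2_def Zq field_simps power2_eq_square)
    have rel: "Z \<zeta> * q * L2 (Z \<zeta>) + Z \<zeta> * L1 (Z \<zeta>) - (A + C + 1) * q * L1 (Z \<zeta>) - A * L0 (Z \<zeta>) = 0"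
      unfolding L0_def L1_def L2_def w_def
      by (rule laplace_kummer_kernel_relation[OF nonpos K a'(1) ReZ]) auto
    let ?z = "exp \<zeta>"
    have "?z\<^sup>2 * (?b \<zeta> * (?b \<zeta> * L0 (Z \<zeta>) - q * L1 (Z \<zeta>))
     + (- ((\<mu> + 1 / 2) / ?z\<^sup>2) * L0 (Z \<zeta>) - ?b \<zeta> * q * L1 (Z \<zeta>) + q\<^sup>2 * L2 (Z \<zeta>))
     + (- 1 / 4 + l / ?z + (1 / 4 - \<mu>\<^sup>2) / ?z\<^sup>2) * L0 (Z \<zeta>)) =
      ?z * (Z \<zeta> * q * L2 (Z \<zeta>) + Z \<zeta> * L1 (Z \<zeta>) - (A + C + 1) * q * L1 (Z \<zeta>) - A * L0 (Z \<zeta>))"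
      unfolding Zq A_def C_def by (simp add: field_simps power2_eq_square)
    then have "?b \<zeta> * (?b \<zeta> * L0 (Z \<zeta>) - q * L1 (Z \<zeta>))
     + (- ((\<mu> + 1 / 2) / ?z\<^sup>2) * L0 (Z \<zeta>) - ?b \<zeta> * q * L1 (Z \<zeta>) + q\<^sup>2 * L2 (Z \<zeta>))
     + (- 1 / 4 + l / ?z + (1 / 4 - \<mu>\<^sup>2) / ?z\<^sup>2) * L0 (Z \<zeta>) = 0"
      unfolding rel by simp
    then have "P \<zeta> * (?b \<zeta> * (?b \<zeta> * L0 (Z \<zeta>) - q * L1 (Z \<zeta>))
     + (- ((\<mu> + 1 / 2) / ?z\<^sup>2) * L0 (Z \<zeta>) - ?b \<zeta> * q * L1 (Z \<zeta>) + q\<^sup>2 * L2 (Z \<zeta>))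
     + (- 1 / 4 + l / ?z + (1 / 4 - \<mu>\<^sup>2) / ?z\<^sup>2) * L0 (Z \<zeta>)) = 0" by (simp only: mult_zero_right)
    moreover have "whittaker_ray l \<mu> \<phi> \<zeta> = P \<zeta> * L0 (Z \<zeta>)"
      by (simp add: whittaker_ray_def P_def L0_def w_def A_def C_def q_def Z_def)
    ultimately show "F2 \<zeta> + (- 1 / 4 + l / ?z + (1 / 4 - \<mu>\<^sup>2) / ?z\<^sup>2) * whittaker_ray l \<mu> \<phi> \<zeta> = 0"
      unfolding F2_def by (simp only: distrib_left mult.assoc mult.left_commute)
  qed
qed

text \<open>Because (\<mu> + 1/2) - l = a, the power of z left after division by z^l and the
  rotation phase merge into the a-th power of the rotated variable z e^(i \<phi>), with its
  logarithm as exponent.\<close>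

lemma whittaker_ray_amplitude:
  fixes l \<mu> :: complex
  defines "a \<equiv> \<mu> - l + 1 / 2"
  shows "whittaker_amplitude l (whittaker_ray l \<mu> \<phi>) \<zeta> =
    exp (a * (\<zeta> + \<i> * of_real \<phi>)) / Gamma a
     * laplace (kummer_kernel a (\<mu> + l - 1 / 2) (cis \<phi>)) (exp (\<zeta> + \<i> * of_real \<phi>))"
proof -
  have "exp (- exp \<zeta> / 2 + (\<mu> + 1 / 2) * \<zeta> + a * (\<i> * of_real \<phi>))
      = exp (a * (\<zeta> + \<i> * of_real \<phi>)) * (exp (- exp \<zeta> / 2) * exp (l * \<zeta>))"
    unfolding exp_add[symmetric] by (rule arg_cong[of _ _ exp]) (simp add: a_def algebra_simps)
  then show ?thesis by (simp add: whittaker_amplitude_def whittaker_ray_def a_def)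
qed

text \<open>First-order Watson lemma. The pure power in the kernel contributes exactly 1; the rest
  of the kernel is O(s^(Re a)), so its transform is O(|z|^(-Re a - 1)), and multiplication by z^a
  leaves O(1/|z|). B must not depend on \<phi>, since the angle will later vary with
  \<zeta>.\<close>

lemma whittaker_ray_asymptotics:
  assumes \<Phi>: "0 \<le> \<Phi>" "\<Phi> < pi" and \<Theta>: "0 \<le> \<Theta>" "\<Theta> < pi / 2"
    and a: "Re (\<mu> - l + 1 / 2) > 0" and c: "Re (\<mu> + l - 1 / 2) \<le> 0"
  obtains B where "\<And>\<phi> \<zeta>. \<bar>\<phi>\<bar> \<le> \<Phi> \<Longrightarrow> \<bar>Im \<zeta> + \<phi>\<bar> \<le> \<Theta> \<Longrightarrow>
    norm (whittaker_amplitude l (whittaker_ray l \<mu> \<phi>) \<zeta> - 1) \<le> B * exp (- Re \<zeta>)"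
proof -
  define A where "A = \<mu> - l + 1 / 2"
  define C where "C = \<mu> + l - 1 / 2"
  have A: "Re A > 0" "Re A + 1 > 0" using a by (auto simp: A_def)
  obtain K0 where K0: "\<And>\<phi> s. \<bar>\<phi>\<bar> \<le> \<Phi> \<Longrightarrow> s \<ge> 0 \<Longrightarrow> norm ((1 + complex_of_real s * cis \<phi>) powr C) \<le> K0"
    using one_plus_ray_powr_bounded[OF \<Phi> c[folded C_def]] by blast
  obtain K where K: "\<And>\<phi> s. \<bar>\<phi>\<bar> \<le> \<Phi> \<Longrightarrow> s \<ge> 0 \<Longrightarrow> norm ((1 + complex_of_real s * cis \<phi>) powr C - 1) \<le> K * s"
    using one_plus_ray_powr_minus_one[OF \<Phi> c[folded C_def]] by blast
  have "norm ((1 + complex_of_real 1 * cis 0) powr C - 1) \<le> K * 1" using K[of 0 1] \<Phi> by simp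
  then have "K \<ge> 0" using order_trans[OF norm_ge_zero] by simp
  have cos\<Theta>: "cos \<Theta> > 0" using \<Theta> by (intro cos_gt_zero_pi) auto
  \<comment> \<open>The first exponential bounds the effect of Im A on the modulus of z^A in the
    sector. The Gamma value and the power of cos \<Theta> come from the Laplace bound, where Re
    (e^Y) >= e^(Re \<zeta>) cos \<Theta>.\<close>
  define B where "B = exp (\<bar>Im A\<bar> * \<Theta>) / norm (Gamma A) * (K * Gamma (Re A + 1) * cos \<Theta> powr - (Re A + 1))"
  show ?thesis
  proof
    fix \<phi> \<zeta> assume \<phi>: "\<bar>\<phi>\<bar> \<le> \<Phi>" and \<zeta>: "\<bar>Im \<zeta> + \<phi>\<bar> \<le> \<Theta>"
    define Y where "Y = \<zeta> + \<i> * of_real \<phi>"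
    define w where "w = kummer_kernel A C (cis \<phi>)"
    define p where "p = (\<lambda>s::real. complex_of_real s powr (A - 1))"
    have Y: "\<bar>Im Y\<bar> \<le> \<Theta>" "Re Y = Re \<zeta>" using \<zeta> by (auto simp: Y_def)
    have "cos \<Theta> \<le> cos \<bar>Im Y\<bar>" using Y \<Theta> by (intro cos_monotone_0_pi_le) auto
    then have cosY: "cos \<Theta> \<le> cos (Im Y)" by simp
    have ReZ: "Re (exp Y) > 0" using Y \<Theta> by (intro Re_exp_pos) linarith
    have nonpos: "1 + complex_of_real s * cis \<phi> \<notin> \<real>\<^sub>\<le>\<^sub>0" if "s > 0" for s
      using one_plus_ray_not_nonpos[of \<phi> s] that \<phi> \<Phi> by simp
    have pbw: "power_bounded (Re A) K0 w"
      unfolding w_def using nonpos K0[OF \<phi>] by (intro power_bounded_kummer_kernel) auto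
    have pbp: "power_bounded (Re A) 1 p"
      using power_bounded_kummer_kernel[of 0 0 1 A] by (simp add: p_def kummer_kernel_def[abs_def])
    have pbd: "power_bounded (Re A + 1) K (\<lambda>s. w s - p s)"
      unfolding power_bounded_def
    proof (intro conjI allI impI)
      show "continuous_on {0<..} (\<lambda>s. w s - p s)"
        using pbw pbp by (auto simp: power_bounded_def intro!: continuous_intros)
      fix s :: real assume s: "s > 0"
      have "w s - p s = p s * ((1 + complex_of_real s * cis \<phi>) powr C - 1)"
        by (simp add: w_def p_def kummer_kernel_def algebra_simps)
      then have "norm (w s - p s) \<le> s powr (Re A - 1) * (K * s)"
        using K[OF \<phi>, of s] s by (simp add: norm_mult p_def norm_of_real_powr mult_left_mono)
      also have "\<dots> = K * s powr (Re A + 1 - 1)"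
        using s powr_mult_base[of s "Re A - 1"] by (simp add: mult_ac)
      finally show "norm (w s - p s) \<le> K * s powr (Re A + 1 - 1)" .
    qed
    \<comment> \<open>The principal logarithm of e^Y is Y itself, because |Im Y| <= \<Theta> <
      pi/2.\<close>
    have "exp Y powr (- A) = exp (- A * Y)"
      using Y \<Theta> by (simp add: powr_def)
    then have lp: "laplace p (exp Y) = Gamma A * exp (- A * Y)"
      using laplace_power[OF A(1) ReZ] by (simp add: p_def)
    have "laplace (\<lambda>s. w s - p s) (exp Y) = laplace w (exp Y) - laplace p (exp Y)"
      unfolding laplace_def right_diff_distrib
      by (rule set_integral_diff(2)[OF power_bounded_integrable[OF pbw A(1) ReZ]
            power_bounded_integrable[OF pbp A(1) ReZ]])
    then have lw: "laplace w (exp Y) = laplace (\<lambda>s. w s - p s) (exp Y) + Gamma A * exp (- A * Y)"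
      by (simp add: lp)
    have G: "Gamma A \<noteq> 0" using A by (auto simp: Gamma_eq_zero_iff elim!: nonpos_Ints_cases)
    have "whittaker_amplitude l (whittaker_ray l \<mu> \<phi>) \<zeta> = exp (A * Y) / Gamma A * laplace w (exp Y)"
      unfolding whittaker_ray_amplitude by (simp add: A_def C_def w_def Y_def)
    also have "\<dots> = exp (A * Y) / Gamma A * laplace (\<lambda>s. w s - p s) (exp Y) + exp (A * Y) * exp (- A * Y)"
      using G by (simp add: lw algebra_simps)
    also have "exp (A * Y) * exp (- A * Y) = 1" by (simp add: exp_add[symmetric])
    finally have "norm (whittaker_amplitude l (whittaker_ray l \<mu> \<phi>) \<zeta> - 1)
        = exp (Re (A * Y)) / norm (Gamma A) * norm (laplace (\<lambda>s. w s - p s) (exp Y))"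
      by (simp add: norm_mult norm_divide)
    also have "\<dots> \<le> exp (Re A * Re \<zeta> + \<bar>Im A\<bar> * \<Theta>) / norm (Gamma A)
        * (K * Gamma (Re A + 1) * ((exp (Re \<zeta>) * cos \<Theta>) powr - (Re A + 1)))"
    proof (rule mult_mono)
      have "- (Im A * Im Y) \<le> \<bar>Im A\<bar> * \<bar>Im Y\<bar>" by (metis abs_ge_minus_self abs_mult)
      also have "\<dots> \<le> \<bar>Im A\<bar> * \<Theta>" using Y by (intro mult_left_mono) auto
      finally have "Re (A * Y) \<le> Re A * Re \<zeta> + \<bar>Im A\<bar> * \<Theta>" using Y by simp
      then show "exp (Re (A * Y)) / norm (Gamma A) \<le> exp (Re A * Re \<zeta> + \<bar>Im A\<bar> * \<Theta>) / norm (Gamma A)"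
        by (intro divide_right_mono) auto
      have "norm (laplace (\<lambda>s. w s - p s) (exp Y)) \<le> K * (Gamma (Re A + 1) * Re (exp Y) powr - (Re A + 1))"
        using laplace_norm_le[OF pbd A(2) ReZ] unfolding gamma_kernel_integral[OF A(2) ReZ] .
      also have "\<dots> \<le> K * (Gamma (Re A + 1) * (exp (Re \<zeta>) * cos \<Theta>) powr - (Re A + 1))"
        using \<open>K \<ge> 0\<close> A cosY cos\<Theta> Gamma_real_pos[OF A(2)]
        by (intro mult_left_mono powr_mono2') (auto simp: Re_exp Y(2))
      finally show "norm (laplace (\<lambda>s. w s - p s) (exp Y))
          \<le> K * Gamma (Re A + 1) * ((exp (Re \<zeta>) * cos \<Theta>) powr - (Re A + 1))" by (simp only: mult.assoc)
    qed auto
    also have "(exp (Re \<zeta>) * cos \<Theta>) powr - (Re A + 1)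
        = exp (- (Re A + 1) * Re \<zeta>) * cos \<Theta> powr - (Re A + 1)"
      using cos\<Theta> by (simp add: powr_mult exp_powr_real mult.commute)
    also have "exp (Re A * Re \<zeta> + \<bar>Im A\<bar> * \<Theta>) / norm (Gamma A)
        * (K * Gamma (Re A + 1) * (exp (- (Re A + 1) * Re \<zeta>) * cos \<Theta> powr - (Re A + 1)))
        = B * (exp (Re A * Re \<zeta>) * exp (- (Re A + 1) * Re \<zeta>))"
      by (simp only: B_def exp_add times_divide_eq_left times_divide_eq_right mult_ac)
    also have "exp (Re A * Re \<zeta>) * exp (- (Re A + 1) * Re \<zeta>) = exp (- Re \<zeta>)"
      unfolding exp_add[symmetric] by (simp add: algebra_simps)
    finally show "norm (whittaker_amplitude l (whittaker_ray l \<mu> \<phi>) \<zeta> - 1) \<le> B * exp (- Re \<zeta>)" .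
  qed
qed

section \<open>Gluing the rays and uniqueness on the full sector\<close>

lemma small_exp_eventually:
  fixes B \<epsilon> :: real
  assumes "\<epsilon> > 0"
  obtains T where "\<And>x. T \<le> x \<Longrightarrow> B * exp (- x) < \<epsilon>"
proof -
  have "((\<lambda>x. B * exp (- x)) \<longlongrightarrow> 0) at_top" by real_asymp
  then have "\<forall>\<^sub>F x in at_top. B * exp (- x) < \<epsilon>" using assms by (rule order_tendstoD)
  then show ?thesis using that unfolding eventually_at_top_linorder by blast
qed

lemma whittaker_ray_tends_to_one:
  assumes \<phi>: "\<bar>\<phi>\<bar> < pi" and a: "Re (\<mu> - l + 1 / 2) > 0" and c: "Re (\<mu> + l - 1 / 2) \<le> 0"
  shows "tends_to_one (- \<phi> - pi / 2) (- \<phi> + pi / 2) (whittaker_amplitude l (whittaker_ray l \<mu> \<phi>))"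
  unfolding tends_to_one_def
proof (intro allI impI)
  fix \<alpha>' \<beta>' \<epsilon> :: real assume *: "- \<phi> - pi / 2 < \<alpha>'" "\<beta>' < - \<phi> + pi / 2" "\<epsilon> > 0"
  \<comment> \<open>The largest |Im \<zeta> + \<phi>| on the substrip; the maximum with 0 covers an
    empty substrip.\<close>
  define \<Theta> where "\<Theta> = max 0 (max (- (\<alpha>' + \<phi>)) (\<beta>' + \<phi>))"
  have \<Theta>: "0 \<le> \<Theta>" "\<Theta> < pi / 2" unfolding \<Theta>_def max_less_iff_conj using * by auto
  obtain B where B: "\<And>\<psi> \<zeta>. \<bar>\<psi>\<bar> \<le> \<bar>\<phi>\<bar> \<Longrightarrow> \<bar>Im \<zeta> + \<psi>\<bar> \<le> \<Theta> \<Longrightarrow>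
      norm (whittaker_amplitude l (whittaker_ray l \<mu> \<psi>) \<zeta> - 1) \<le> B * exp (- Re \<zeta>)"
    using whittaker_ray_asymptotics[OF abs_ge_zero \<phi> \<Theta> a c] by blast
  obtain T where T: "\<And>x. T \<le> x \<Longrightarrow> B * exp (- x) < \<epsilon>" using small_exp_eventually[OF *(3)] by blast
  show "\<exists>T. \<forall>\<zeta>. T \<le> Re \<zeta> \<and> \<alpha>' \<le> Im \<zeta> \<and> Im \<zeta> \<le> \<beta>' \<longrightarrow>
      norm (whittaker_amplitude l (whittaker_ray l \<mu> \<phi>) \<zeta> - 1) < \<epsilon>"
  proof (intro exI[of _ T] allI impI)
    fix \<zeta> assume "T \<le> Re \<zeta> \<and> \<alpha>' \<le> Im \<zeta> \<and> Im \<zeta> \<le> \<beta>'"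
    then show "norm (whittaker_amplitude l (whittaker_ray l \<mu> \<phi>) \<zeta> - 1) < \<epsilon>"
      using T[of "Re \<zeta>"] by (intro le_less_trans[OF B]) (auto simp: \<Theta>_def abs_le_iff)
  qed
qed

text \<open>The two sectors overlap, as \<zeta> lies in both, and since both angles are below pi in
  modulus the overlap reaches below arg z = pi/2 and above -pi/2. It therefore contains a ray in the
  right half-plane, where uniqueness applies.\<close>

lemma whittaker_ray_agree:
  assumes \<phi>: "\<bar>\<phi>\<bar> < pi" "\<bar>\<psi>\<bar> < pi" and a: "Re (\<mu> - l + 1 / 2) > 0" and c: "Re (\<mu> + l - 1 / 2) \<le> 0"
    and \<zeta>: "\<bar>Im \<zeta> + \<phi>\<bar> < pi / 2" "\<bar>Im \<zeta> + \<psi>\<bar> < pi / 2"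
  shows "whittaker_ray l \<mu> \<phi> \<zeta> = whittaker_ray l \<mu> \<psi> \<zeta>"
proof -
  define \<alpha> where "\<alpha> = max (- \<phi>) (- \<psi>) - pi / 2"
  define \<beta> where "\<beta> = min (- \<phi>) (- \<psi>) + pi / 2"
  have lt: "max \<alpha> (- pi / 2) < min \<beta> (pi / 2)"
    using \<phi> \<zeta> unfolding \<alpha>_def \<beta>_def abs_less_iff max_def min_def by (auto split: if_splits)
  obtain \<theta> where "max \<alpha> (- pi / 2) < \<theta>" "\<theta> < min \<beta> (pi / 2)" using dense[OF lt] by blast
  then have \<theta>: "\<alpha> < \<theta>" "\<theta> < \<beta>" "\<bar>\<theta>\<bar> < pi / 2" unfolding abs_less_iff by auto
  have sub: "horizontal_strip \<alpha> \<beta> \<subseteq> horizontal_strip (- \<phi> - pi / 2) (- \<phi> + pi / 2)"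
    "horizontal_strip \<alpha> \<beta> \<subseteq> horizontal_strip (- \<psi> - pi / 2) (- \<psi> + pi / 2)"
    by (auto simp: horizontal_strip_def \<alpha>_def \<beta>_def)
  show ?thesis
  proof (rule whittaker_ode_unique[OF whittaker_ode_subset[OF whittaker_ray_ode[OF \<phi>(1) a c] sub(1)] _
        whittaker_ode_subset[OF whittaker_ray_ode[OF \<phi>(2) a c] sub(2)] _ \<theta>])
    show "tends_to_one \<alpha> \<beta> (whittaker_amplitude l (whittaker_ray l \<mu> \<phi>))"
      by (rule tends_to_one_mono[OF whittaker_ray_tends_to_one[OF \<phi>(1) a c]]) (auto simp: \<alpha>_def \<beta>_def)
    show "tends_to_one \<alpha> \<beta> (whittaker_amplitude l (whittaker_ray l \<mu> \<psi>))"
      by (rule tends_to_one_mono[OF whittaker_ray_tends_to_one[OF \<phi>(2) a c]]) (auto simp: \<alpha>_def \<beta>_def)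
    show "\<zeta> \<in> horizontal_strip \<alpha> \<beta>"
      using \<zeta> unfolding abs_less_iff by (auto simp: horizontal_strip_def \<alpha>_def \<beta>_def)
  qed
qed

text \<open>
  Turning the ray by \<open>\<phi> = - 2/3 arg z\<close> leaves \<open>\<bar>arg z + \<phi>\<bar> = \<bar>arg z\<bar> / 3 < \<pi>/2\<close> and
  \<open>\<bar>\<phi>\<bar> < \<pi>\<close> throughout the sector \<open>\<bar>arg z\<bar> < 3\<pi>/2\<close>.
\<close>

theorem whittaker_solution_exists:
  assumes a: "Re (\<mu> - l + 1 / 2) > 0" and c: "Re (\<mu> + l - 1 / 2) \<le> 0"
  shows "whittaker_solution l \<mu> (\<lambda>\<zeta>. whittaker_ray l \<mu> (- (2 / 3 * Im \<zeta>)) \<zeta>)"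
    (is "whittaker_solution l \<mu> ?F")
  unfolding whittaker_solution_iff
proof
  let ?S = "horizontal_strip (- (3 * pi / 2)) (3 * pi / 2)"
  \<comment> \<open>The candidate uses a rotation angle depending on Im \<zeta>, so holomorphy is
    not visible from its formula. On the sector of any fixed angle it coincides with the integral
    for that angle and inherits the equation.\<close>
  have loc: "whittaker_ode l \<mu> (?S \<inter> horizontal_strip (- \<phi> - pi / 2) (- \<phi> + pi / 2)) ?F" if \<phi>: "\<bar>\<phi>\<bar> < pi" for \<phi>
  proof (rule whittaker_ode_cong)
    show "whittaker_ode l \<mu> (?S \<inter> horizontal_strip (- \<phi> - pi / 2) (- \<phi> + pi / 2)) (whittaker_ray l \<mu> \<phi>)"
      by (rule whittaker_ode_subset[OF whittaker_ray_ode[OF \<phi> a c]]) auto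
    show "?F \<zeta> = whittaker_ray l \<mu> \<phi> \<zeta>"
      if "\<zeta> \<in> ?S \<inter> horizontal_strip (- \<phi> - pi / 2) (- \<phi> + pi / 2)" for \<zeta>
    proof (rule whittaker_ray_agree[OF _ \<phi> a c])
      show "\<bar>- (2 / 3 * Im \<zeta>)\<bar> < pi" "\<bar>Im \<zeta> + - (2 / 3 * Im \<zeta>)\<bar> < pi / 2" "\<bar>Im \<zeta> + \<phi>\<bar> < pi / 2"
        using that unfolding abs_less_iff by (auto simp: horizontal_strip_def)
    qed
  qed (auto intro!: open_Int)
  have cover: "\<zeta> \<in> ?S \<inter> horizontal_strip (2 / 3 * Im \<zeta> - pi / 2) (2 / 3 * Im \<zeta> + pi / 2)
      \<and> \<bar>- (2 / 3 * Im \<zeta>)\<bar> < pi" if "\<zeta> \<in> ?S" for \<zeta>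
    using that unfolding abs_less_iff by (auto simp: horizontal_strip_def)
  show "whittaker_ode l \<mu> ?S ?F"
    unfolding whittaker_ode_def
  proof (intro conjI ballI)
    have "?F field_differentiable (at \<zeta>)" if "\<zeta> \<in> ?S" for \<zeta>
      using loc[of "- (2 / 3 * Im \<zeta>)"] cover[OF that] unfolding whittaker_ode_def
      by (auto intro!: holomorphic_on_imp_differentiable_at[OF _ open_Int[OF horizontal_strip_open horizontal_strip_open]])
    then show "?F holomorphic_on ?S"
      by (auto simp: holomorphic_on_def intro: field_differentiable_at_within)
    fix \<zeta> assume "\<zeta> \<in> ?S"
    then show "z_deriv (z_deriv ?F) \<zeta> + (- 1 / 4 + l / exp \<zeta> + (1 / 4 - \<mu>\<^sup>2) / (exp \<zeta>)\<^sup>2) * ?F \<zeta> = 0"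
      using loc[of "- (2 / 3 * Im \<zeta>)"] cover unfolding whittaker_ode_def by auto
  qed
  show "tends_to_one (- (3 * pi / 2)) (3 * pi / 2) (whittaker_amplitude l ?F)"
    unfolding tends_to_one_def
  proof (intro allI impI)
    fix \<alpha>' \<beta>' \<epsilon> :: real assume *: "- (3 * pi / 2) < \<alpha>'" "\<beta>' < 3 * pi / 2" "\<epsilon> > 0"
    \<comment> \<open>A bound for |arg z| on the substrip. The ray then turns by at most 2M/3 and
      leaves an angle of at most M/3, so one constant B serves all angles at once.\<close>
    define M where "M = max 0 (max (- \<alpha>') \<beta>')"
    have "0 \<le> M" "M < 3 * pi / 2" unfolding M_def max_less_iff_conj using * by auto
    then have M: "0 \<le> 2 / 3 * M" "2 / 3 * M < pi" "0 \<le> M / 3" "M / 3 < pi / 2" by auto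
    obtain B where B: "\<And>\<phi> \<zeta>. \<bar>\<phi>\<bar> \<le> 2 / 3 * M \<Longrightarrow> \<bar>Im \<zeta> + \<phi>\<bar> \<le> M / 3 \<Longrightarrow>
        norm (whittaker_amplitude l (whittaker_ray l \<mu> \<phi>) \<zeta> - 1) \<le> B * exp (- Re \<zeta>)"
      using whittaker_ray_asymptotics[OF M a c] by blast
    obtain T where T: "\<And>x. T \<le> x \<Longrightarrow> B * exp (- x) < \<epsilon>" using small_exp_eventually[OF *(3)] by blast
    show "\<exists>T. \<forall>\<zeta>. T \<le> Re \<zeta> \<and> \<alpha>' \<le> Im \<zeta> \<and> Im \<zeta> \<le> \<beta>' \<longrightarrow> norm (whittaker_amplitude l ?F \<zeta> - 1) < \<epsilon>"
    proof (intro exI[of _ T] allI impI)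
      fix \<zeta> assume z: "T \<le> Re \<zeta> \<and> \<alpha>' \<le> Im \<zeta> \<and> Im \<zeta> \<le> \<beta>'"
      then have "\<bar>Im \<zeta>\<bar> \<le> M" by (auto simp: M_def)
      then have "norm (whittaker_amplitude l (whittaker_ray l \<mu> (- (2 / 3 * Im \<zeta>))) \<zeta> - 1) < \<epsilon>"
        using T[of "Re \<zeta>"] z by (intro le_less_trans[OF B]) auto
      then show "norm (whittaker_amplitude l ?F \<zeta> - 1) < \<epsilon>" by (simp add: whittaker_amplitude_def)
    qed
  qed
qed

lemma whittaker_solution_unique:
  assumes "whittaker_solution l \<mu> F" "whittaker_solution l \<mu> G" "\<bar>Im \<zeta>\<bar> < 3 * pi / 2"
  shows "F \<zeta> = G \<zeta>"
proof (rule whittaker_ode_unique[of l \<mu> "- (3 * pi / 2)" "3 * pi / 2" F G 0 \<zeta>])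
  show "\<zeta> \<in> horizontal_strip (- (3 * pi / 2)) (3 * pi / 2)"
    using assms(3) unfolding abs_less_iff horizontal_strip_def by auto
  show "- (3 * pi / 2) < 0" "0 < 3 * pi / 2" "\<bar>0::real\<bar> < pi / 2" by auto
qed (use assms in \<open>auto simp: whittaker_solution_iff\<close>)

text \<open>Makes the definite description computable: uniqueness applies at \<open>Ln z\<close>,
  whose imaginary part lies in (-pi, pi] and hence inside the strip.\<close>

lemma whittaker_W_eqI:
  assumes "whittaker_solution l \<mu> F" "z \<noteq> 0"
  shows "whittaker_W l \<mu> z = F (Ln z)"
  unfolding whittaker_W_def
proof (rule the_equality)
  show "\<exists>G. whittaker_solution l \<mu> G \<and> F (Ln z) = G (Ln z)" using assms(1) by blast
  fix w assume "\<exists>G. whittaker_solution l \<mu> G \<and> w = G (Ln z)"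
  then obtain G where G: "whittaker_solution l \<mu> G" "w = G (Ln z)" by blast
  have "\<bar>Im (Ln z)\<bar> < 3 * pi / 2"
    using Im_Ln_le_pi[OF assms(2)] mpi_less_Im_Ln[OF assms(2)] pi_gt_zero unfolding abs_less_iff by linarith
  then show "w = F (Ln z)" using whittaker_solution_unique[OF G(1) assms(1)] G(2) by simp
qed

section \<open>Oscillator modes\<close>

lemma bounded_continuous_set_integrable:
  fixes f :: "real \<Rightarrow> 'a::{banach, second_countable_topology}"
  assumes "continuous_on {a<..<b} f" "\<And>x. x \<in> {a<..<b} \<Longrightarrow> norm (f x) \<le> B"
  shows "set_integrable lborel {a<..<b} f"
proof (rule set_integrable_bound[where f = "\<lambda>_. B"])
  have "set_integrable lborel {a..b} (\<lambda>_. B)" by (intro borel_integrable_atLeastAtMost' continuous_intros)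
  then show "set_integrable lborel {a<..<b} (\<lambda>_. B)" by (rule set_integrable_subset) auto
  show "set_borel_measurable lborel {a<..<b} f"
    unfolding set_borel_measurable_def
    using borel_measurable_continuous_on_indicator[OF _ assms(1)] by simp
  show "AE x in lborel. x \<in> {a<..<b} \<longrightarrow> norm (f x) \<le> norm B"
    using assms(2) by (intro AE_I2) fastforce
qed

lemma set_integral_Ioo_split:
  fixes f :: "real \<Rightarrow> 'a::{banach, second_countable_topology}"
  assumes "a \<le> b" "b \<le> c" "set_integrable lborel {a<..<c} f"
  shows "(LBINT x:{a<..<c}. f x) = (LBINT x:{a<..<b}. f x) + (LBINT x:{b<..<c}. f x)"
proof -
  have "(LBINT x=ereal a..ereal b. f x) + (LBINT x=ereal b..ereal c. f x) = (LBINT x=ereal a..ereal c. f x)"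
    using assms by (intro interval_integral_sum)
      (simp add: interval_lebesgue_integrable_def min_def max_def)
  then show ?thesis using assms by (simp add: interval_integral_Ioo)
qed

lemma set_integral_FTC:
  fixes f F :: "real \<Rightarrow> complex"
  assumes "a \<le> b" "continuous_on {a..b} f"
    and "\<And>x. a \<le> x \<Longrightarrow> x \<le> b \<Longrightarrow> (F has_vector_derivative f x) (at x)"
  shows "(LBINT x:{a<..<b}. f x) = F b - F a"
proof -
  have "(LBINT x=ereal a..ereal b. f x) = F b - F a"
    using assms by (intro interval_integral_FTC_finite)
      (auto simp: min_def max_def intro: has_vector_derivative_at_within)
  then show ?thesis using assms(1) by (simp add: interval_integral_Ioo)
qed

text \<open>Separates the S-J argument from special functions: only the equation and the WKB
  behaviour at infinity enter. \<open>M\<close> is the mass scale mt, \<open>A\<close> the limiting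
  squared amplitude, \<open>g1\<close> the derivative of g. \<open>phase\<close> selects
  instantaneous frequency M \<eta> with negative sign.\<close>

locale oscillator_mode =
  fixes k M A :: real and g g1 :: "real \<Rightarrow> complex"
  assumes A: "A > 0" and M: "M > 0"
    and d0: "\<And>\<eta>. \<eta> > 0 \<Longrightarrow> (g has_vector_derivative g1 \<eta>) (at \<eta>)"
    and d1: "\<And>\<eta>. \<eta> > 0 \<Longrightarrow>
      (g1 has_vector_derivative - (of_real (k\<^sup>2 + M\<^sup>2 * \<eta>\<^sup>2) * g \<eta>)) (at \<eta>)"
    and amp: "((\<lambda>\<eta>. \<eta> * (norm (g \<eta>))\<^sup>2) \<longlongrightarrow> A) at_top"
    and phase: "((\<lambda>\<eta>. g1 \<eta> / (of_real \<eta> * g \<eta>)) \<longlongrightarrow> - \<i> * of_real M) at_top"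
begin

lemma continuous_g: "continuous_on {0<..} g" and continuous_g1: "continuous_on {0<..} g1"
  using d0 d1 by (auto intro!: continuous_at_imp_continuous_on has_vector_derivative_continuous)

lemma eventually_nonzero: "\<forall>\<^sub>F \<eta> in at_top. \<eta> > 0 \<and> g \<eta> \<noteq> 0 \<and> A / 2 < \<eta> * (norm (g \<eta>))\<^sup>2"
proof -
  have "\<forall>\<^sub>F \<eta> in at_top. A / 2 < \<eta> * (norm (g \<eta>))\<^sup>2" using A by (intro order_tendstoD[OF amp]) auto
  then show ?thesis using eventually_gt_at_top[of 0] by eventually_elim (use A in auto)
qed

text \<open>The coefficient is real, so \<open>cnj g\<close> solves the same equation and the
  Wronskian is constant. With q = g'/(\<eta> g) it equals \<eta> |g|^2 (cnj q - q), whose limit at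
  infinity fixes the constant.\<close>

lemma wronskian:
  assumes "\<eta> > 0"
  shows "g \<eta> * cnj (g1 \<eta>) - cnj (g \<eta>) * g1 \<eta> = 2 * \<i> * of_real (M * A)"
proof -
  let ?w = "\<lambda>\<eta>. g \<eta> * cnj (g1 \<eta>) - cnj (g \<eta>) * g1 \<eta>"
  have "\<exists>c. \<forall>\<eta>\<in>{0<..}. ?w \<eta> = c"
  proof (rule has_derivative_zero_constant)
    fix \<eta> :: real assume "\<eta> \<in> {0<..}"
    then have \<eta>: "\<eta> > 0" by simp
    note D = d0[OF \<eta>] d1[OF \<eta>] has_vector_derivative_cnj[OF d0[OF \<eta>]] has_vector_derivative_cnj[OF d1[OF \<eta>]]
    have "(?w has_vector_derivative 0) (at \<eta>)"
      using has_vector_derivative_diff[OF has_vector_derivative_mult[OF D(1,4)] has_vector_derivative_mult[OF D(3,2)]]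
      by (simp add: algebra_simps)
    then show "(?w has_derivative (\<lambda>h. 0)) (at \<eta> within {0<..})"
      unfolding has_vector_derivative_def by (auto intro: has_derivative_at_withinI)
  qed simp
  then obtain c where c: "\<And>\<eta>. \<eta> > 0 \<Longrightarrow> ?w \<eta> = c" by auto
  let ?q = "\<lambda>\<eta>. g1 \<eta> / (of_real \<eta> * g \<eta>)"
  have "((\<lambda>\<eta>. of_real (\<eta> * (norm (g \<eta>))\<^sup>2) * (cnj (?q \<eta>) - ?q \<eta>)) \<longlongrightarrow>
      of_real A * (cnj (- \<i> * of_real M) - (- \<i> * of_real M))) at_top"
    by (intro tendsto_intros amp phase)
  moreover have "\<forall>\<^sub>F \<eta> in at_top. of_real (\<eta> * (norm (g \<eta>))\<^sup>2) * (cnj (?q \<eta>) - ?q \<eta>) = c"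
    using eventually_nonzero
  proof eventually_elim
    case (elim \<eta>)
    have "of_real (\<eta> * (norm (g \<eta>))\<^sup>2) * (cnj (?q \<eta>) - ?q \<eta>)
        = of_real \<eta> * (g \<eta> * cnj (g \<eta>)) * (cnj (?q \<eta>) - ?q \<eta>)"
      by (simp only: of_real_mult complex_norm_square)
    also have "\<dots> = ?w \<eta>" using elim by (simp add: field_simps)
    finally show ?case using c elim by simp
  qed
  ultimately have "((\<lambda>_::real. c) \<longlongrightarrow> of_real A * (cnj (- \<i> * of_real M) - (- \<i> * of_real M))) at_top"
    using Lim_transform_eventually by fastforce
  then have "c = 2 * \<i> * of_real (M * A)" by (simp add: tendsto_const_iff)
  then show ?thesis using c[OF assms] by simp
qed

text \<open>
  Near \<open>\<eta> = 0\<close> the coefficient of the equation is bounded, so \<open>(\<bar>g\<bar>\<^sup>2 + \<bar>g'\<bar>\<^sup>2) e\<^bsup>c\<eta>\<^esup>\<close> is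
  nondecreasing on \<open>(0, 1]\<close> for large \<open>c\<close>.
\<close>

lemma bounded_near_zero:
  obtains C where "\<And>\<eta>. 0 < \<eta> \<Longrightarrow> \<eta> \<le> 1 \<Longrightarrow> norm (g \<eta>) \<le> C"
proof -
  \<comment> \<open>On (0, 1] the derivative of H is 2 (1 - Q) (u u1 + v v1) with Q = k^2 + M^2 t^2;
    this c dominates |1 - Q|, and H dominates 2 |u u1 + v v1|.\<close>
  define c where "c = 1 + k\<^sup>2 + M\<^sup>2"
  define H where "H = (\<lambda>\<eta>. (Re (g \<eta>))\<^sup>2 + (Im (g \<eta>))\<^sup>2 + (Re (g1 \<eta>))\<^sup>2 + (Im (g1 \<eta>))\<^sup>2)"
  have "H \<eta> * exp (c * \<eta>) \<le> H 1 * exp (c * 1)" if \<eta>: "0 < \<eta>" "\<eta> \<le> 1" for \<eta>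
  proof (rule DERIV_nonneg_imp_nondecreasing[OF \<eta>(2)])
    fix t :: real assume t: "\<eta> \<le> t" "t \<le> 1"
    then have t0: "t > 0" using \<eta> by simp
    define Q where "Q = k\<^sup>2 + M\<^sup>2 * t\<^sup>2"
    let ?u = "Re (g t)" and ?v = "Im (g t)" and ?u1 = "Re (g1 t)" and ?v1 = "Im (g1 t)"
    have D: "((\<lambda>t. Re (g t)) has_field_derivative ?u1) (at t)" "((\<lambda>t. Im (g t)) has_field_derivative ?v1) (at t)"
      "((\<lambda>t. Re (g1 t)) has_field_derivative - Q * ?u) (at t)"
      "((\<lambda>t. Im (g1 t)) has_field_derivative - Q * ?v) (at t)"
      using d0[OF t0] d1[OF t0] unfolding has_vector_derivative_complex_iff Q_def[symmetric] by auto
    have "((\<lambda>t. H t * exp (c * t)) has_field_derivative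
        (2 * (1 - Q) * (?u * ?u1 + ?v * ?v1) + c * H t) * exp (c * t)) (at t)"
      unfolding H_def by (rule derivative_eq_intros D refl)+ (simp add: algebra_simps power2_eq_square)
    moreover have "0 \<le> 2 * (1 - Q) * (?u * ?u1 + ?v * ?v1) + c * H t"
    proof -
      have tri: "\<bar>2 * (?u * ?u1 + ?v * ?v1)\<bar> \<le> H t"
      proof -
        have "0 \<le> (?u - ?u1)\<^sup>2 + (?v - ?v1)\<^sup>2" "0 \<le> (?u + ?u1)\<^sup>2 + (?v + ?v1)\<^sup>2" by auto
        then show ?thesis unfolding H_def abs_le_iff by (simp add: power2_eq_square algebra_simps)
      qed
      have "t\<^sup>2 \<le> 1" using t t0 by (simp add: power_le_one)
      then have "M\<^sup>2 * t\<^sup>2 \<le> M\<^sup>2" using mult_left_mono[of "t\<^sup>2" 1 "M\<^sup>2"] by simp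
      moreover have "0 \<le> M\<^sup>2 * t\<^sup>2" "0 \<le> k\<^sup>2" "0 \<le> M\<^sup>2" by auto
      ultimately have "\<bar>1 - Q\<bar> \<le> c" unfolding Q_def c_def abs_le_iff by (intro conjI) linarith+
      then have "\<bar>1 - Q\<bar> * \<bar>2 * (?u * ?u1 + ?v * ?v1)\<bar> \<le> c * H t"
        using tri by (intro mult_mono) (auto simp: c_def)
      then have "\<bar>(1 - Q) * (2 * (?u * ?u1 + ?v * ?v1))\<bar> \<le> c * H t" by (simp only: abs_mult)
      then show ?thesis unfolding abs_le_iff by (simp add: algebra_simps)
    qed
    ultimately show "\<exists>y. ((\<lambda>t. H t * exp (c * t)) has_field_derivative y) (at t) \<and> 0 \<le> y"
      using mult_nonneg_nonneg[OF _ exp_ge_zero[of "c * t"]] by blast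
  qed
  then have H: "H \<eta> \<le> H 1 * exp c" if "0 < \<eta>" "\<eta> \<le> 1" for \<eta>
  proof -
    have "H \<eta> * 1 \<le> H \<eta> * exp (c * \<eta>)" using that by (intro mult_left_mono) (auto simp: H_def c_def)
    then show ?thesis using \<open>\<And>\<eta>. 0 < \<eta> \<Longrightarrow> \<eta> \<le> 1 \<Longrightarrow> H \<eta> * exp (c * \<eta>) \<le> H 1 * exp (c * 1)\<close>[OF that] by simp
  qed
  show ?thesis
  proof
    fix \<eta> :: real assume \<eta>: "0 < \<eta>" "\<eta> \<le> 1"
    have "norm (g \<eta>) \<le> sqrt (H \<eta>)" unfolding cmod_def H_def by simp
    also have "\<dots> \<le> sqrt (H 1 * exp c)" using H[OF \<eta>] by simp
    finally show "norm (g \<eta>) \<le> sqrt (H 1 * exp c)" .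
  qed
qed

lemma bounded:
  obtains C where "\<And>\<eta>. 0 < \<eta> \<Longrightarrow> norm (g \<eta>) \<le> C"
proof -
  obtain C0 where C0: "\<And>\<eta>. 0 < \<eta> \<Longrightarrow> \<eta> \<le> 1 \<Longrightarrow> norm (g \<eta>) \<le> C0" using bounded_near_zero by blast
  have "\<forall>\<^sub>F \<eta> in at_top. \<eta> * (norm (g \<eta>))\<^sup>2 < A + 1" using order_tendstoD(2)[OF amp] by simp
  then obtain T where T: "\<And>\<eta>. T \<le> \<eta> \<Longrightarrow> \<eta> * (norm (g \<eta>))\<^sup>2 < A + 1" unfolding eventually_at_top_linorder by blast
  have "compact (g ` {1..max 1 T})"
    by (intro compact_continuous_image continuous_on_subset[OF continuous_g]) auto
  then obtain C1 where C1: "\<And>\<eta>. 1 \<le> \<eta> \<Longrightarrow> \<eta> \<le> max 1 T \<Longrightarrow> norm (g \<eta>) \<le> C1"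
    using compact_imp_bounded[of "g ` {1..max 1 T}"] unfolding bounded_iff by fastforce
  show ?thesis
  proof
    fix \<eta> :: real assume \<eta>: "0 < \<eta>"
    consider "\<eta> \<le> 1" | "1 \<le> \<eta>" "\<eta> \<le> max 1 T" | "1 \<le> \<eta>" "T \<le> \<eta>" by linarith
    then show "norm (g \<eta>) \<le> max C0 (max C1 (sqrt (A + 1)))"
    proof cases
      case 3
      have "(norm (g \<eta>))\<^sup>2 \<le> \<eta> * (norm (g \<eta>))\<^sup>2" using 3 by (simp add: mult_le_cancel_right1)
      then have "norm (g \<eta>) \<le> sqrt (A + 1)" using T[OF 3(2)] by (intro real_le_rsqrt) simp
      then show ?thesis by simp
    qed (use C0 C1 \<eta> in \<open>auto simp: le_max_iff_disj\<close>)
  qed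
qed

lemma integrable_Ioo:
  assumes "continuous_on {0<..} f" "\<And>\<eta>. 0 < \<eta> \<Longrightarrow> \<eta> < \<Lambda> \<Longrightarrow> norm (f \<eta>) \<le> K * (norm (g \<eta>))\<^sup>2" "K \<ge> 0"
  shows "set_integrable lborel {0<..<\<Lambda>} (f :: real \<Rightarrow> complex)"
proof -
  obtain C where C: "\<And>\<eta>. 0 < \<eta> \<Longrightarrow> norm (g \<eta>) \<le> C" using bounded by blast
  show ?thesis
  proof (rule bounded_continuous_set_integrable)
    show "continuous_on {0<..<\<Lambda>} f" by (rule continuous_on_subset[OF assms(1)]) auto
    fix \<eta> assume "\<eta> \<in> {0<..<\<Lambda>}"
    then have "norm (f \<eta>) \<le> K * (norm (g \<eta>))\<^sup>2" "(norm (g \<eta>))\<^sup>2 \<le> C\<^sup>2" using assms(2) C by (auto intro: power_mono)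
    then show "norm (f \<eta>) \<le> K * C\<^sup>2" using assms(3) by (meson mult_left_mono order_trans)
  qed
qed

lemma integrable_square: "set_integrable lborel {0<..<\<Lambda>} (\<lambda>\<eta>. (g \<eta>)\<^sup>2 * of_real (\<eta>\<^sup>2))"
  and integrable_norm_square: "set_integrable lborel {0<..<\<Lambda>} (\<lambda>\<eta>. cnj (g \<eta>) * g \<eta> * of_real (\<eta>\<^sup>2))"
proof -
  show "set_integrable lborel {0<..<\<Lambda>} (\<lambda>\<eta>. (g \<eta>)\<^sup>2 * of_real (\<eta>\<^sup>2))"
    by (rule integrable_Ioo[where K = "\<Lambda>\<^sup>2"])
      (auto intro!: continuous_intros continuous_g mult_right_mono power_mono
        simp: norm_mult norm_power mult.commute[of "_\<^sup>2" "(cmod _)\<^sup>2"] mult_left_mono)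
  show "set_integrable lborel {0<..<\<Lambda>} (\<lambda>\<eta>. cnj (g \<eta>) * g \<eta> * of_real (\<eta>\<^sup>2))"
    by (rule integrable_Ioo[where K = "\<Lambda>\<^sup>2"])
      (auto intro!: continuous_intros continuous_g mult_right_mono power_mono
        simp: norm_mult norm_power power2_eq_square[of "cmod _"] mult.commute[of "_\<^sup>2" "cmod _ * _"] mult_left_mono)
qed

text \<open>
  The virial identity below expresses \<open>\<integral> \<eta>\<^sup>2 g\<^sup>2\<close> by boundary terms and \<open>\<integral> g\<^sup>2\<close>. Since
  \<open>g' \<sim> - i M \<eta> g\<close>, the boundary term \<open>\<eta> (g'\<^sup>2 + M\<^sup>2 \<eta>\<^sup>2 g\<^sup>2)\<close> cancels to leading order, so no
  oscillatory integral has to be estimated.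
\<close>

definition virial :: "real \<Rightarrow> complex" where
  "virial \<eta> = of_real \<eta> * ((g1 \<eta>)\<^sup>2 + of_real (k\<^sup>2 + M\<^sup>2 * \<eta>\<^sup>2) * (g \<eta>)\<^sup>2) - g \<eta> * g1 \<eta>"

text \<open>With Q = k^2 + M^2 \<eta>^2, the equation cancels the terms Q g g' and the correction -
  g g' removes g'^2. What remains is (2 Q + \<eta> Q') g^2.\<close>

lemma virial_derivative:
  assumes "\<eta> > 0"
  shows "(virial has_vector_derivative
     2 * of_real (k\<^sup>2) * (g \<eta>)\<^sup>2 + 4 * of_real (M\<^sup>2) * ((g \<eta>)\<^sup>2 * of_real (\<eta>\<^sup>2))) (at \<eta>)"
proof -
  note D = d0[OF assms] d1[OF assms]
  have Q: "((\<lambda>\<eta>. complex_of_real (k\<^sup>2 + M\<^sup>2 * \<eta>\<^sup>2)) has_vector_derivative of_real (2 * M\<^sup>2 * \<eta>)) (at \<eta>)"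
    by (rule has_vector_derivative_of_real) (rule derivative_eq_intros refl | simp)+
  have I: "(complex_of_real has_vector_derivative 1) (at \<eta>)"
    using has_vector_derivative_of_real[OF DERIV_ident] by simp
  have "((\<lambda>\<eta>. of_real \<eta> * (g1 \<eta> * g1 \<eta> + of_real (k\<^sup>2 + M\<^sup>2 * \<eta>\<^sup>2) * (g \<eta> * g \<eta>)) - g \<eta> * g1 \<eta>)
      has_vector_derivative 2 * of_real (k\<^sup>2) * (g \<eta>)\<^sup>2 + 4 * of_real (M\<^sup>2) * ((g \<eta>)\<^sup>2 * of_real (\<eta>\<^sup>2))) (at \<eta>)"
    by (rule has_vector_derivative_eq_rhs)
      (rule has_vector_derivative_diff has_vector_derivative_add has_vector_derivative_mult I Q D
       | simp add: algebra_simps power2_eq_square)+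
  then show ?thesis by (simp add: virial_def[abs_def] power2_eq_square)
qed

text \<open>Dividing by \<eta>^2 leaves \<eta> g^2, of bounded modulus, times q^2 + M^2 + o(1) with
  q = g'/(\<eta> g) -> - i M, and (- i M)^2 + M^2 = 0.\<close>

lemma virial_tendsto: "((\<lambda>\<eta>. virial \<eta> / of_real (\<eta>\<^sup>2)) \<longlongrightarrow> 0) at_top"
proof -
  let ?q = "\<lambda>\<eta>. g1 \<eta> / (of_real \<eta> * g \<eta>)"
  let ?e = "\<lambda>\<eta>. (?q \<eta>)\<^sup>2 + of_real (k\<^sup>2 / \<eta>\<^sup>2 + M\<^sup>2) - of_real (1 / \<eta>\<^sup>2) * ?q \<eta>"
  have "((\<lambda>\<eta>::real. k\<^sup>2 / \<eta>\<^sup>2 + M\<^sup>2) \<longlongrightarrow> M\<^sup>2) at_top" "((\<lambda>\<eta>::real. 1 / \<eta>\<^sup>2) \<longlongrightarrow> 0) at_top" by real_asymp+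
  then have "(?e \<longlongrightarrow> (- \<i> * of_real M)\<^sup>2 + of_real (M\<^sup>2) - of_real 0 * (- \<i> * of_real M)) at_top"
    by (intro tendsto_intros phase)
  then have "((\<lambda>\<eta>. norm (?e \<eta>)) \<longlongrightarrow> 0) at_top" by (simp add: power_mult_distrib tendsto_norm_zero)
  then have "((\<lambda>\<eta>. \<eta> * (norm (g \<eta>))\<^sup>2 * norm (?e \<eta>)) \<longlongrightarrow> A * 0) at_top"
    by (intro tendsto_intros amp)
  then have lim: "((\<lambda>\<eta>. \<eta> * (norm (g \<eta>))\<^sup>2 * norm (?e \<eta>)) \<longlongrightarrow> 0) at_top" by simp
  show ?thesis
  proof (rule Lim_null_comparison[OF _ lim])
    show "\<forall>\<^sub>F \<eta> in at_top. norm (virial \<eta> / of_real (\<eta>\<^sup>2)) \<le> \<eta> * (norm (g \<eta>))\<^sup>2 * norm (?e \<eta>)"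
      using eventually_nonzero
    proof eventually_elim
      case (elim \<eta>)
      then have "virial \<eta> / of_real (\<eta>\<^sup>2) = of_real \<eta> * (g \<eta>)\<^sup>2 * ?e \<eta>"
        unfolding virial_def by (simp add: field_simps power2_eq_square)
      then show ?case using elim by (simp add: norm_mult norm_power)
    qed
  qed
qed

text \<open>The virial identity is integrated from 1, where its boundary term is a plain constant;
  the piece on (0, 1) is another constant. Boundedness of g makes the remaining integral of g^2 at
  most O(\<Lambda>).\<close>

lemma oscillating_integral_tendsto:
  "((\<lambda>\<Lambda>. (LBINT \<eta>:{0<..<\<Lambda>}. (g \<eta>)\<^sup>2 * of_real (\<eta>\<^sup>2)) / of_real (\<Lambda>\<^sup>2)) \<longlongrightarrow> 0) at_top"
proof -
  obtain C where C: "\<And>\<eta>. 0 < \<eta> \<Longrightarrow> norm (g \<eta>) \<le> C" using bounded by blast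
  define N1 where "N1 = (LBINT \<eta>:{0<..<1}. (g \<eta>)\<^sup>2 * complex_of_real (\<eta>\<^sup>2))"
  define I where "I = (\<lambda>\<Lambda>. LBINT \<eta>:{1<..<\<Lambda>}. (g \<eta>)\<^sup>2)"
  let ?h = "\<lambda>\<Lambda>. N1 / of_real (\<Lambda>\<^sup>2) + (virial \<Lambda> / of_real (\<Lambda>\<^sup>2) - virial 1 / of_real (\<Lambda>\<^sup>2)
     - 2 * of_real (k\<^sup>2) * (I \<Lambda> / of_real (\<Lambda>\<^sup>2))) / (4 * of_real (M\<^sup>2))"
  have I_int: "set_integrable lborel {1<..<\<Lambda>} (\<lambda>\<eta>. (g \<eta>)\<^sup>2)" for \<Lambda>
  proof -
    have "set_integrable lborel {0<..<\<Lambda>} (\<lambda>\<eta>. (g \<eta>)\<^sup>2)"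
      by (rule integrable_Ioo[where K = 1]) (auto intro!: continuous_intros continuous_g simp: norm_power)
    then show ?thesis by (rule set_integrable_subset) auto
  qed
  have I: "norm (I \<Lambda> / of_real (\<Lambda>\<^sup>2)) \<le> C\<^sup>2 * (\<Lambda> - 1) / \<Lambda>\<^sup>2" if \<Lambda>: "1 \<le> \<Lambda>" for \<Lambda>
  proof -
    have cint: "set_integrable lborel {1<..<\<Lambda>} (\<lambda>_. C\<^sup>2)"
      by (intro bounded_continuous_set_integrable[where B = "C\<^sup>2"] continuous_intros) auto
    have "norm (I \<Lambda>) \<le> (LBINT \<eta>:{1<..<\<Lambda>}. C\<^sup>2)"
      unfolding I_def using C by (intro set_integral_norm_le[OF I_int cint]) (auto simp: norm_power intro!: power_mono)
    also have "\<dots> = C\<^sup>2 * (\<Lambda> - 1)" using \<Lambda> by (simp add: set_lebesgue_integral_def)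
    finally show ?thesis using \<Lambda> by (simp add: norm_divide norm_power divide_right_mono)
  qed
  have inv: "((\<lambda>\<Lambda>::real. c / complex_of_real (\<Lambda>\<^sup>2)) \<longlongrightarrow> 0) at_top" for c
  proof (rule Lim_null_comparison)
    show "\<forall>\<^sub>F \<Lambda> in at_top. norm (c / complex_of_real (\<Lambda>\<^sup>2)) \<le> norm c / \<Lambda>\<^sup>2"
      by (simp add: norm_divide norm_power)
    show "((\<lambda>\<Lambda>::real. norm c / \<Lambda>\<^sup>2) \<longlongrightarrow> 0) at_top" by real_asymp
  qed
  have Ilim: "((\<lambda>\<Lambda>. I \<Lambda> / of_real (\<Lambda>\<^sup>2)) \<longlongrightarrow> 0) at_top"
  proof (rule Lim_null_comparison)
    show "\<forall>\<^sub>F \<Lambda> in at_top. norm (I \<Lambda> / of_real (\<Lambda>\<^sup>2)) \<le> C\<^sup>2 * (\<Lambda> - 1) / \<Lambda>\<^sup>2"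
      using eventually_ge_at_top[of 1] by (rule eventually_mono) (rule I)
    show "((\<lambda>\<Lambda>::real. C\<^sup>2 * (\<Lambda> - 1) / \<Lambda>\<^sup>2) \<longlongrightarrow> 0) at_top" by real_asymp
  qed
  have "(?h \<longlongrightarrow> 0 + (0 - 0 - 2 * of_real (k\<^sup>2) * 0) / (4 * of_real (M\<^sup>2))) at_top"
    using M by (intro tendsto_intros inv Ilim virial_tendsto) auto
  moreover have "\<forall>\<^sub>F \<Lambda> in at_top. ?h \<Lambda> = (LBINT \<eta>:{0<..<\<Lambda>}. (g \<eta>)\<^sup>2 * of_real (\<eta>\<^sup>2)) / of_real (\<Lambda>\<^sup>2)"
    using eventually_ge_at_top[of 1]
  proof eventually_elim
    case (elim \<Lambda>)
    define J where "J = (LBINT \<eta>:{1<..<\<Lambda>}. (g \<eta>)\<^sup>2 * complex_of_real (\<eta>\<^sup>2))"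
    have J_int: "set_integrable lborel {1<..<\<Lambda>} (\<lambda>\<eta>. (g \<eta>)\<^sup>2 * complex_of_real (\<eta>\<^sup>2))"
      by (rule set_integrable_subset[OF integrable_square]) auto
    have i1: "set_integrable lborel {1<..<\<Lambda>} (\<lambda>\<eta>. 2 * of_real (k\<^sup>2) * (g \<eta>)\<^sup>2)"
      by (intro set_integrable_mult_right I_int)
    have i2: "set_integrable lborel {1<..<\<Lambda>} (\<lambda>\<eta>. 4 * of_real (M\<^sup>2) * ((g \<eta>)\<^sup>2 * complex_of_real (\<eta>\<^sup>2)))"
      by (intro set_integrable_mult_right J_int)
    have "(LBINT \<eta>:{1<..<\<Lambda>}. 2 * of_real (k\<^sup>2) * (g \<eta>)\<^sup>2 + 4 * of_real (M\<^sup>2) * ((g \<eta>)\<^sup>2 * complex_of_real (\<eta>\<^sup>2)))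
        = virial \<Lambda> - virial 1"
    proof (rule set_integral_FTC[OF elim])
      show "continuous_on {1..\<Lambda>}
          (\<lambda>\<eta>. 2 * of_real (k\<^sup>2) * (g \<eta>)\<^sup>2 + 4 * of_real (M\<^sup>2) * ((g \<eta>)\<^sup>2 * complex_of_real (\<eta>\<^sup>2)))"
        by (rule continuous_on_subset[of "{0<..}"]) (auto intro!: continuous_intros continuous_g)
      show "(virial has_vector_derivative 2 * of_real (k\<^sup>2) * (g x)\<^sup>2
          + 4 * of_real (M\<^sup>2) * ((g x)\<^sup>2 * complex_of_real (x\<^sup>2))) (at x)" if "1 \<le> x" for x
        using that by (intro virial_derivative) simp
    qed
    then have "virial \<Lambda> - virial 1 = 2 * of_real (k\<^sup>2) * I \<Lambda> + 4 * of_real (M\<^sup>2) * J"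
      using set_integral_add(2)[OF i1 i2] by (simp only: set_integral_mult_right I_def J_def)
    then have "J = (virial \<Lambda> - virial 1 - 2 * of_real (k\<^sup>2) * I \<Lambda>) / (4 * of_real (M\<^sup>2))"
      using M by (simp add: field_simps)
    moreover have "(LBINT \<eta>:{0<..<\<Lambda>}. (g \<eta>)\<^sup>2 * of_real (\<eta>\<^sup>2)) = N1 + J"
      unfolding N1_def J_def by (rule set_integral_Ioo_split) (use elim integrable_square in auto)
    moreover have "n / x + (v / x - w / x - c * (i / x)) / d = (n + (v - w - c * i) / d) / x"
      for n x v w c i d :: complex
      by (simp add: divide_inverse algebra_simps)
    ultimately show ?case by simp
  qed
  ultimately show ?thesis using Lim_transform_eventually by fastforce
qed

text \<open>The constant: beyond T the integrand exceeds (A/2) \<eta>, integration gives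
  (A/4)(\<Lambda>^2 - T^2), and \<Lambda> >= 2 T makes the bracket at least \<Lambda>^2 / 2.\<close>

lemma norm_integral_ge:
  "\<forall>\<^sub>F \<Lambda> in at_top. A / 8 * \<Lambda>\<^sup>2 \<le> (LBINT \<eta>:{0<..<\<Lambda>}. (norm (g \<eta>))\<^sup>2 * \<eta>\<^sup>2)"
proof -
  obtain T0 where T0: "\<And>\<eta>. T0 \<le> \<eta> \<Longrightarrow> A / 2 < \<eta> * (norm (g \<eta>))\<^sup>2"
    using eventually_nonzero unfolding eventually_at_top_linorder by blast
  define T where "T = max T0 1"
  have T: "T > 0" "\<And>\<eta>. T \<le> \<eta> \<Longrightarrow> A / 2 < \<eta> * (norm (g \<eta>))\<^sup>2" using T0 by (auto simp: T_def)
  show ?thesis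
    using eventually_ge_at_top[of "2 * T"]
  proof eventually_elim
    case (elim \<Lambda>)
    let ?f = "\<lambda>\<eta>. (norm (g \<eta>))\<^sup>2 * \<eta>\<^sup>2"
    have "set_integrable lborel {0<..<\<Lambda>} (\<lambda>\<eta>. norm (cnj (g \<eta>) * g \<eta> * of_real (\<eta>\<^sup>2)))"
      by (rule set_integrable_norm[OF integrable_norm_square])
    then have int: "set_integrable lborel {0<..<\<Lambda>} ?f" by (simp add: norm_mult norm_power power2_eq_square)
    have int': "set_integrable lborel {T<..<\<Lambda>} ?f" by (rule set_integrable_subset[OF int]) (use T in auto)
    have lin: "set_integrable lborel {T<..<\<Lambda>} (\<lambda>\<eta>. A / 2 * \<eta>)"
      by (rule set_integrable_subset[OF borel_integrable_atLeastAtMost'[of T \<Lambda>]]) (auto intro!: continuous_intros)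
    have "A / 8 * \<Lambda>\<^sup>2 \<le> A / 4 * (\<Lambda>\<^sup>2 - T\<^sup>2)"
    proof -
      have "(2 * T)\<^sup>2 \<le> \<Lambda>\<^sup>2" using elim T by (intro power_mono) auto
      then have "4 * T\<^sup>2 \<le> \<Lambda>\<^sup>2" by (simp add: power_mult_distrib)
      then have "1 / 2 * \<Lambda>\<^sup>2 \<le> \<Lambda>\<^sup>2 - T\<^sup>2" using zero_le_power2[of T] by linarith
      from mult_left_mono[OF this, of "A / 4"] show ?thesis using A by simp
    qed
    also have "A / 4 * (\<Lambda>\<^sup>2 - T\<^sup>2) = (LBINT \<eta>:{T<..<\<Lambda>}. A / 2 * \<eta>)"
    proof -
      have "complex_of_real (LBINT \<eta>:{T<..<\<Lambda>}. A / 2 * \<eta>) = (LBINT \<eta>:{T<..<\<Lambda>}. complex_of_real (A / 2 * \<eta>))"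
        by (rule set_integral_complex_of_real[symmetric])
      also have "\<dots> = of_real (A / 4 * \<Lambda>\<^sup>2) - of_real (A / 4 * T\<^sup>2)"
      proof (rule set_integral_FTC)
        show "((\<lambda>x. complex_of_real (A / 4 * x\<^sup>2)) has_vector_derivative complex_of_real (A / 2 * x)) (at x)" for x
          by (rule has_vector_derivative_of_real) (rule derivative_eq_intros refl | simp)+
      qed (use elim T in \<open>auto intro!: continuous_intros\<close>)
      also have "\<dots> = of_real (A / 4 * (\<Lambda>\<^sup>2 - T\<^sup>2))" by (simp add: algebra_simps)
      finally show ?thesis using of_real_eq_iff by metis
    qed
    also have "\<dots> \<le> (LBINT \<eta>:{T<..<\<Lambda>}. ?f \<eta>)"
    proof (rule set_integral_mono[OF lin int'])
      fix \<eta> assume "\<eta> \<in> {T<..<\<Lambda>}"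
      then have "A / 2 * \<eta> \<le> \<eta> * (norm (g \<eta>))\<^sup>2 * \<eta>"
        using T(2)[of \<eta>] T(1) by (intro mult_right_mono) auto
      then show "A / 2 * \<eta> \<le> ?f \<eta>" by (simp add: power2_eq_square mult_ac)
    qed
    also have "\<dots> \<le> (LBINT \<eta>:{0<..<T}. ?f \<eta>) + (LBINT \<eta>:{T<..<\<Lambda>}. ?f \<eta>)"
      by (simp add: set_lebesgue_integral_def integral_nonneg_AE)
    also have "\<dots> = (LBINT \<eta>:{0<..<\<Lambda>}. ?f \<eta>)"
      by (rule set_integral_Ioo_split[symmetric]) (use T elim int in auto)
    finally show ?case .
  qed
qed

lemma ratio_tendsto:
  "((\<lambda>\<Lambda>. norm (LBINT \<eta>:{0<..<\<Lambda>}. (g \<eta>)\<^sup>2 * of_real (\<eta>\<^sup>2)) /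
     (LBINT \<eta>:{0<..<\<Lambda>}. (norm (g \<eta>))\<^sup>2 * \<eta>\<^sup>2)) \<longlongrightarrow> 0) at_top"
    (is "((\<lambda>\<Lambda>. norm (?N \<Lambda>) / ?D \<Lambda>) \<longlongrightarrow> 0) at_top")
proof (rule Lim_null_comparison)
  have "((\<lambda>\<Lambda>. norm (?N \<Lambda> / of_real (\<Lambda>\<^sup>2)) * (8 / A)) \<longlongrightarrow> 0 * (8 / A)) at_top"
    by (intro tendsto_intros tendsto_norm_zero oscillating_integral_tendsto)
  then show "((\<lambda>\<Lambda>. norm (?N \<Lambda> / of_real (\<Lambda>\<^sup>2)) * (8 / A)) \<longlongrightarrow> 0) at_top" by simp
  show "\<forall>\<^sub>F \<Lambda> in at_top. norm (norm (?N \<Lambda>) / ?D \<Lambda>) \<le> norm (?N \<Lambda> / of_real (\<Lambda>\<^sup>2)) * (8 / A)"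
    using norm_integral_ge eventually_gt_at_top[of 0]
  proof eventually_elim
    case (elim \<Lambda>)
    have pos: "0 < A / 8 * \<Lambda>\<^sup>2" using A elim by simp
    have "norm (norm (?N \<Lambda>) / ?D \<Lambda>) = norm (?N \<Lambda>) / ?D \<Lambda>" using pos elim by simp
    also have "\<dots> \<le> norm (?N \<Lambda>) / (A / 8 * \<Lambda>\<^sup>2)"
      using A elim less_le_trans[OF pos elim(1)] by (intro divide_left_mono mult_pos_pos) auto
    also have "\<dots> = norm (?N \<Lambda> / of_real (\<Lambda>\<^sup>2)) * (8 / A)"
      by (simp add: norm_divide norm_power mult.commute)
    finally show ?case .
  qed
qed

end

section \<open>The S-J modes\<close>

lemma Ln_imaginary:
  assumes "x > 0"
  shows "Ln (\<i> * complex_of_real x) = Complex (ln x) (pi / 2)"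
    and "exp (Complex (ln x) (pi / 2)) = \<i> * complex_of_real x"
proof -
  show *: "exp (Complex (ln x) (pi / 2)) = \<i> * complex_of_real x"
    using assms by (simp add: exp_eq_polar exp_of_real[symmetric] mult.commute)
  show "Ln (\<i> * complex_of_real x) = Complex (ln x) (pi / 2)"
    by (rule Ln_unique[OF *]) auto
qed

text \<open>Liouville transformation with z = i M \<eta>^2: the factor \<eta>^(-1/2) is proportional
  to (dz/d\<eta>)^(-1/2) and removes the first-order term. The exponential in the amplitude is the
  square of |e^(-z/2) z^l| on arg z = pi/2.\<close>

lemma whittaker_oscillator_mode:
  fixes k M c :: real and l :: complex and F :: "complex \<Rightarrow> complex" and g :: "real \<Rightarrow> complex"
  assumes M: "M > 0" and c: "c > 0" and l: "l = - \<i> * of_real (k\<^sup>2) / (4 * of_real M)"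
    and F: "whittaker_solution l (1 / 4) F"
    and g: "\<And>\<eta>. \<eta> > 0 \<Longrightarrow> g \<eta> = of_real (c * \<eta> powr (- 1 / 2)) * F (Complex (ln (M * \<eta>\<^sup>2)) (pi / 2))"
  obtains g1 where "oscillator_mode k M (c\<^sup>2 * exp (pi * k\<^sup>2 / (4 * M))) g g1"
proof -
  let ?S = "horizontal_strip (- (3 * pi / 2)) (3 * pi / 2)"
  let ?R = "whittaker_amplitude l F"
  define \<zeta> where "\<zeta> = (\<lambda>\<eta>. Complex (ln (M * \<eta>\<^sup>2)) (pi / 2))"
  define W0 where "W0 = (\<lambda>\<eta>. F (\<zeta> \<eta>))"
  define W1 where "W1 = (\<lambda>\<eta>. z_deriv F (\<zeta> \<eta>))"
  define p where "p = (\<lambda>\<eta>. c * \<eta> powr (- 1 / 2))"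
  \<comment> \<open>Product and chain rule: p' W + p W' dz/d\<eta> with dz/d\<eta> = 2 i M
    \<eta>.\<close>
  define g1 where "g1 = (\<lambda>\<eta>. of_real (- p \<eta> / (2 * \<eta>)) * W0 \<eta> + of_real (2 * M * \<eta> * p \<eta>) * (\<i> * W1 \<eta>))"
  have ode: "whittaker_ode l (1 / 4) ?S F" and one: "tends_to_one (- (3 * pi / 2)) (3 * pi / 2) ?R"
    using F by (auto simp: whittaker_solution_iff)
  then have hol: "F holomorphic_on ?S" by (simp add: whittaker_ode_def)
  have \<zeta>_in: "\<zeta> \<eta> \<in> ?S" for \<eta> by (simp add: \<zeta>_def horizontal_strip_def)
  have exp_\<zeta>: "exp (\<zeta> \<eta>) = \<i> * of_real (M * \<eta>\<^sup>2)" if "\<eta> > 0" for \<eta>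
    unfolding \<zeta>_def using Ln_imaginary(2)[of "M * \<eta>\<^sup>2"] M that by simp
  have d\<zeta>: "(\<zeta> has_vector_derivative of_real (2 / \<eta>)) (at \<eta>)" if \<eta>: "\<eta> > 0" for \<eta>
  proof -
    have "((\<lambda>\<eta>. M * \<eta>\<^sup>2) has_real_derivative M * (2 * \<eta>)) (at \<eta>)"
      by (rule derivative_eq_intros refl | simp)+
    from DERIV_chain2[OF DERIV_ln_divide this]
    have "((\<lambda>\<eta>. ln (M * \<eta>\<^sup>2)) has_real_derivative 2 / \<eta>) (at \<eta>)"
      using M \<eta> by (simp add: power2_eq_square)
    then show ?thesis unfolding \<zeta>_def has_vector_derivative_complex_iff by simp
  qed
  have dW0: "(W0 has_vector_derivative 2 * \<i> * of_real (M * \<eta>) * W1 \<eta>) (at \<eta>)" if \<eta>: "\<eta> > 0" for \<eta>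
    unfolding W0_def W1_def
    using field_vector_diff_chain_at[OF d\<zeta>[OF \<eta>] z_deriv_eqs(1)[OF ode horizontal_strip_open \<zeta>_in]] \<eta>
    by (simp add: o_def exp_\<zeta> power2_eq_square mult_ac)
  have dW1: "(W1 has_vector_derivative 2 * \<i> * of_real (M * \<eta>) *
      ((1 / 4 - l / (\<i> * of_real (M * \<eta>\<^sup>2)) - (3 / 16) / (\<i> * of_real (M * \<eta>\<^sup>2))\<^sup>2) * W0 \<eta>)) (at \<eta>)"
    if \<eta>: "\<eta> > 0" for \<eta>
  proof -
    have "(W1 has_vector_derivative of_real (2 / \<eta>) *
      ((1 / 4 - l / exp (\<zeta> \<eta>) - (1 / 4 - (1 / 4)\<^sup>2) / (exp (\<zeta> \<eta>))\<^sup>2) * F (\<zeta> \<eta>) * exp (\<zeta> \<eta>))) (at \<eta>)"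
      unfolding W1_def
      using field_vector_diff_chain_at[OF d\<zeta>[OF \<eta>] z_deriv_eqs(2)[OF ode horizontal_strip_open \<zeta>_in]]
      by (simp add: o_def)
    also have "of_real (2 / \<eta>) * ((1 / 4 - l / exp (\<zeta> \<eta>) - (1 / 4 - (1 / 4)\<^sup>2) / (exp (\<zeta> \<eta>))\<^sup>2) * F (\<zeta> \<eta>) * exp (\<zeta> \<eta>))
      = (of_real (2 / \<eta>) * exp (\<zeta> \<eta>)) * ((1 / 4 - l / exp (\<zeta> \<eta>) - (3 / 16) / (exp (\<zeta> \<eta>))\<^sup>2) * W0 \<eta>)"
      by (simp add: W0_def power2_eq_square)
    also have "of_real (2 / \<eta>) * exp (\<zeta> \<eta>) = 2 * \<i> * of_real (M * \<eta>)"
      using \<eta> by (simp add: exp_\<zeta> power2_eq_square)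
    finally show ?thesis by (simp only: exp_\<zeta>[OF \<eta>])
  qed
  have dp: "(p has_real_derivative - p \<eta> / (2 * \<eta>)) (at \<eta>)" if \<eta>: "\<eta> > 0" for \<eta>
  proof -
    have "(p has_real_derivative c * ((- 1 / 2) * \<eta> powr (- 1 / 2 - 1))) (at \<eta>)"
      unfolding p_def by (intro DERIV_cmult has_real_derivative_powr \<eta>)
    also have "c * ((- 1 / 2) * \<eta> powr (- 1 / 2 - 1)) = - p \<eta> / (2 * \<eta>)"
      unfolding p_def powr_diff using \<eta> by simp
    finally show ?thesis .
  qed
  show ?thesis
  proof (rule that[of g1], unfold_locales)
    show "c\<^sup>2 * exp (pi * k\<^sup>2 / (4 * M)) > 0" "M > 0" using c M by auto
    fix \<eta> :: real assume \<eta>: "\<eta> > 0"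
    have "((\<lambda>\<eta>. of_real (p \<eta>) * W0 \<eta>) has_vector_derivative g1 \<eta>) (at \<eta>)"
      by (rule has_vector_derivative_eq_rhs,
          rule has_vector_derivative_mult[OF has_vector_derivative_of_real[OF dp[OF \<eta>]] dW0[OF \<eta>]])
        (simp add: g1_def mult_ac)
    then show "(g has_vector_derivative g1 \<eta>) (at \<eta>)"
      by (rule has_vector_derivative_transform_within_open[of _ _ _ "{0<..}"])
        (use \<eta> g in \<open>auto simp: p_def W0_def \<zeta>_def\<close>)
    have dq: "((\<lambda>\<eta>. - p \<eta> / (2 * \<eta>)) has_real_derivative 3 * p \<eta> / (4 * \<eta>\<^sup>2)) (at \<eta>)"
      by (rule DERIV_cong[OF DERIV_divide[OF DERIV_minus[OF dp[OF \<eta>]] DERIV_cmult_Id]])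
        (use \<eta> in \<open>simp_all add: field_simps power2_eq_square\<close>)
    have dr: "((\<lambda>\<eta>. 2 * M * \<eta> * p \<eta>) has_real_derivative M * p \<eta>) (at \<eta>)"
      by (rule DERIV_cong[OF DERIV_mult[OF DERIV_cmult_Id dp[OF \<eta>]]])
        (use \<eta> in \<open>simp add: field_simps\<close>)
    let ?z = "\<i> * complex_of_real (M * \<eta>\<^sup>2)"
    have iW1: "((\<lambda>\<eta>. \<i> * W1 \<eta>) has_vector_derivative \<i> * (2 * \<i> * of_real (M * \<eta>) *
      ((1 / 4 - l / ?z - (3 / 16) / ?z\<^sup>2) * W0 \<eta>))) (at \<eta>)"
      by (rule has_vector_derivative_mult_right[OF dW1[OF \<eta>]])
    have "(g1 has_vector_derivative
        of_real (- p \<eta> / (2 * \<eta>)) * (2 * \<i> * of_real (M * \<eta>) * W1 \<eta>) + of_real (3 * p \<eta> / (4 * \<eta>\<^sup>2)) * W0 \<eta>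
      + (of_real (2 * M * \<eta> * p \<eta>) * (\<i> * (2 * \<i> * of_real (M * \<eta>) *
      ((1 / 4 - l / ?z - (3 / 16) / ?z\<^sup>2) * W0 \<eta>))) + of_real (M * p \<eta>) * (\<i> * W1 \<eta>))) (at \<eta>)"
      unfolding g1_def
      by (intro has_vector_derivative_add has_vector_derivative_mult has_vector_derivative_of_real dq dr iW1 dW0[OF \<eta>])
    \<comment> \<open>The two \<open>W1\<close> terms cancel. In the coefficient of
      \<open>W0\<close>, \<mu> = 1/4 gives 1/4 - \<mu>^2 = 3/16, which cancels 3 p / (4 \<eta>^2);
      the term 1/4 produces M^2 \<eta>^2, and l produces k^2.\<close>
    also have "of_real (- p \<eta> / (2 * \<eta>)) * (2 * \<i> * of_real (M * \<eta>) * W1 \<eta>) + of_real (3 * p \<eta> / (4 * \<eta>\<^sup>2)) * W0 \<eta>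
      + (of_real (2 * M * \<eta> * p \<eta>) * (\<i> * (2 * \<i> * of_real (M * \<eta>) *
      ((1 / 4 - l / ?z - (3 / 16) / ?z\<^sup>2) * W0 \<eta>))) + of_real (M * p \<eta>) * (\<i> * W1 \<eta>))
      = - (of_real (k\<^sup>2 + M\<^sup>2 * \<eta>\<^sup>2) * (of_real (p \<eta>) * W0 \<eta>))"
    proof -
      have z2: "?z\<^sup>2 = - (of_real (M * \<eta>\<^sup>2))\<^sup>2" by (simp add: power_mult_distrib)
      have lz: "l / ?z = - of_real (k\<^sup>2 / (4 * M\<^sup>2 * \<eta>\<^sup>2))"
        unfolding l using M \<eta> by (simp add: field_simps power2_eq_square)
      show ?thesis unfolding z2 lz using M \<eta> by (simp add: field_simps power2_eq_square)
    qed
    also have "of_real (p \<eta>) * W0 \<eta> = g \<eta>" using g[OF \<eta>] by (simp add: p_def W0_def \<zeta>_def)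
    finally show "(g1 has_vector_derivative - (of_real (k\<^sup>2 + M\<^sup>2 * \<eta>\<^sup>2) * g \<eta>)) (at \<eta>)" .
  next
    have ln_top: "filterlim (\<lambda>\<eta>. ln (M * \<eta>\<^sup>2)) at_top at_top" using M by real_asymp
    have strip: "- (3 * pi / 2) < pi / 2" "pi / 2 < 3 * pi / 2" by auto
    have R: "((\<lambda>\<eta>. ?R (\<zeta> \<eta>)) \<longlongrightarrow> 1) at_top"
      unfolding \<zeta>_def by (rule filterlim_compose[OF tendsto_along_ray[OF one strip] ln_top])
    have R': "((\<lambda>\<eta>. deriv ?R (\<zeta> \<eta>)) \<longlongrightarrow> 0) at_top"
      unfolding \<zeta>_def
      by (rule filterlim_compose[OF deriv_tendsto_along_ray[OF one strip whittaker_amplitude_holomorphic[OF hol]] ln_top])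
    have "((\<lambda>\<eta>. c\<^sup>2 * exp (pi * k\<^sup>2 / (4 * M)) * (norm (?R (\<zeta> \<eta>)))\<^sup>2) \<longlongrightarrow>
        c\<^sup>2 * exp (pi * k\<^sup>2 / (4 * M)) * (norm (1 :: complex))\<^sup>2) at_top"
      by (intro tendsto_intros R)
    moreover have "\<forall>\<^sub>F \<eta> in at_top. c\<^sup>2 * exp (pi * k\<^sup>2 / (4 * M)) * (norm (?R (\<zeta> \<eta>)))\<^sup>2 = \<eta> * (norm (g \<eta>))\<^sup>2"
      using eventually_gt_at_top[of 0]
    proof eventually_elim
      case (elim \<eta>)
      \<comment> \<open>z is purely imaginary, so e^(-z/2) has modulus 1; |z^l| comes from Re (l
        \<zeta>) = - Im l * pi/2, as l is imaginary.\<close>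
      have "norm (exp (- exp (\<zeta> \<eta>) / 2) * exp (l * \<zeta> \<eta>)) = exp (pi * k\<^sup>2 / (8 * M))"
        unfolding norm_mult norm_exp_eq_Re exp_\<zeta>[OF elim] exp_add[symmetric]
        by (simp add: l \<zeta>_def Re_divide_of_real[of _ "4 * M", simplified])
      then have "norm (W0 \<eta>) = exp (pi * k\<^sup>2 / (8 * M)) * norm (?R (\<zeta> \<eta>))"
        unfolding W0_def by (subst whittaker_amplitude_mult[of F _ l]) (simp only: norm_mult)
      moreover have "(exp (pi * k\<^sup>2 / (8 * M)))\<^sup>2 = exp (pi * k\<^sup>2 / (4 * M))"
        by (simp add: power2_eq_square exp_add[symmetric])
      moreover have "\<eta> * (p \<eta>)\<^sup>2 = c\<^sup>2"
      proof -
        have "(\<eta> powr (- 1 / 2))\<^sup>2 = inverse \<eta>"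
          using elim by (simp add: powr_minus powr_half_sqrt power_inverse)
        then show ?thesis using elim by (simp add: p_def power_mult_distrib)
      qed
      moreover have "norm (g \<eta>) = p \<eta> * norm (W0 \<eta>)"
        using g[OF elim] c by (simp add: p_def W0_def \<zeta>_def norm_mult)
      ultimately show ?case by (simp add: power_mult_distrib)
    qed
    ultimately show "((\<lambda>\<eta>. \<eta> * (norm (g \<eta>))\<^sup>2) \<longlongrightarrow> c\<^sup>2 * exp (pi * k\<^sup>2 / (4 * M))) at_top"
      using Lim_transform_eventually by fastforce
    have inv: "((\<lambda>\<eta>. w / (\<i> * complex_of_real (M * \<eta>\<^sup>2))) \<longlongrightarrow> 0) at_top" for w
    proof (rule Lim_null_comparison)
      show "\<forall>\<^sub>F \<eta> in at_top. norm (w / (\<i> * complex_of_real (M * \<eta>\<^sup>2))) \<le> norm w / (M * \<eta>\<^sup>2)"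
        using M by (simp add: norm_divide norm_mult norm_power)
      show "((\<lambda>\<eta>::real. norm w / (M * \<eta>\<^sup>2)) \<longlongrightarrow> 0) at_top" using M by real_asymp
    qed
    let ?z = "\<lambda>\<eta>. \<i> * complex_of_real (M * \<eta>\<^sup>2)"
    \<comment> \<open>g'/(\<eta> g) in terms of the amplitude, with every correction written as a
      multiple of 1/z. Only (2 i M)(-1/2) = - i M survives.\<close>
    let ?h = "\<lambda>\<eta>. - (\<i> * of_real M) * (1 / 2 / ?z \<eta>)
       + 2 * \<i> * of_real M * ((l / ?z \<eta> - 1 / 2) + deriv ?R (\<zeta> \<eta>) / ?R (\<zeta> \<eta>) * (1 / ?z \<eta>))"
    have "(?h \<longlongrightarrow> - (\<i> * of_real M) * 0 + 2 * \<i> * of_real M * ((0 - 1 / 2) + 0 / 1 * 0)) at_top"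
      by (intro tendsto_intros R R' inv) auto
    moreover have "\<forall>\<^sub>F \<eta> in at_top. ?R (\<zeta> \<eta>) \<noteq> 0"
      by (rule tendsto_imp_eventually_ne[OF R]) simp
    then have "\<forall>\<^sub>F \<eta> in at_top. ?h \<eta> = g1 \<eta> / (of_real \<eta> * g \<eta>)"
      using eventually_gt_at_top[of 0]
    proof eventually_elim
      case (elim \<eta>)
      let ?E = "exp (- exp (\<zeta> \<eta>) / 2) * exp (l * \<zeta> \<eta>)"
      have W0: "W0 \<eta> = ?E * ?R (\<zeta> \<eta>)" unfolding W0_def by (rule whittaker_amplitude_mult)
      have "W1 \<eta> = ?E * ((l / ?z \<eta> - 1 / 2) * ?R (\<zeta> \<eta>) + deriv ?R (\<zeta> \<eta>) / ?z \<eta>)"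
        unfolding W1_def using z_deriv_amplitude[OF hol horizontal_strip_open \<zeta>_in[of \<eta>], of l] exp_\<zeta>[OF elim(2)] by simp
      then have W1: "W1 \<eta> = W0 \<eta> * ((l / ?z \<eta> - 1 / 2) + deriv ?R (\<zeta> \<eta>) / ?R (\<zeta> \<eta>) * (1 / ?z \<eta>))"
        using elim by (simp add: W0 field_simps)
      have nz: "W0 \<eta> \<noteq> 0" "p \<eta> \<noteq> 0" using elim c by (auto simp: W0 p_def)
      have "g \<eta> = of_real (p \<eta>) * W0 \<eta>" using g[OF elim(2)] by (simp add: p_def W0_def \<zeta>_def)
      then have "g1 \<eta> / (of_real \<eta> * g \<eta>) = - of_real (1 / (2 * \<eta>\<^sup>2)) + 2 * \<i> * of_real M * (W1 \<eta> / W0 \<eta>)"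
        using nz elim(2) by (simp add: g1_def field_simps power2_eq_square)
      also have "W1 \<eta> / W0 \<eta> = (l / ?z \<eta> - 1 / 2) + deriv ?R (\<zeta> \<eta>) / ?R (\<zeta> \<eta>) * (1 / ?z \<eta>)"
        unfolding W1 using nz by simp
      also have "- complex_of_real (1 / (2 * \<eta>\<^sup>2)) = - (\<i> * of_real M) * (1 / 2 / ?z \<eta>)"
        using M elim by (simp add: field_simps)
      finally show ?case by (rule sym)
    qed
    ultimately have "((\<lambda>\<eta>. g1 \<eta> / (of_real \<eta> * g \<eta>)) \<longlongrightarrow>
        - (\<i> * of_real M) * 0 + 2 * \<i> * of_real M * ((0 - 1 / 2) + 0 / 1 * 0)) at_top"
      by (rule Lim_transform_eventually)
    then show "((\<lambda>\<eta>. g1 \<eta> / (of_real \<eta> * g \<eta>)) \<longlongrightarrow> - \<i> * of_real M) at_top" by simp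
  qed
qed

text \<open>The phase with \<open>Arg\<close> may fail to converge, but it has modulus 1 and its
  coefficient tends to 0. The first coefficient tends to sqrt 2 and cancels the 2 under the root of
  the prefactor.\<close>

lemma SJ_mode_tendsto:
  assumes "((\<lambda>\<Lambda>. SJ_ratio a g \<Lambda>) \<longlongrightarrow> 0) at_top"
  shows "((\<lambda>\<Lambda>. SJ_mode a g kv \<Lambda> \<eta> x) \<longlongrightarrow>
    exp (\<i> * of_real (kv \<bullet> x)) / of_real (sqrt ((2 * pi) ^ 3) * a \<eta>) * g \<eta>) at_top"
proof -
  let ?s = "\<lambda>\<Lambda>. 1 / sqrt (1 - (SJ_ratio a g \<Lambda>)\<^sup>2)"
  let ?u = "\<lambda>\<Lambda>. exp (\<i> * complex_of_real (Arg (eta_inner a \<Lambda> (conj_fun g) g))) * cnj (g \<eta>)"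
  have "(?s \<longlongrightarrow> 1 / sqrt (1 - 0\<^sup>2)) at_top"
    by (intro tendsto_intros assms) auto
  then have s: "(?s \<longlongrightarrow> 1) at_top" by simp
  have "((\<lambda>\<Lambda>. sqrt (- 1 + ?s \<Lambda>)) \<longlongrightarrow> sqrt (- 1 + 1)) at_top"
    by (intro tendsto_intros s)
  \<comment> \<open>The absolute value is taken because \<open>sqrt\<close> is negative at negative
    arguments, and the argument is not known to be nonnegative for every cutoff.\<close>
  then have lim: "((\<lambda>\<Lambda>. \<bar>sqrt (- 1 + ?s \<Lambda>)\<bar> * norm (g \<eta>)) \<longlongrightarrow> 0) at_top"
    by (intro tendsto_mult_left_zero tendsto_rabs_zero) simp
  have u: "((\<lambda>\<Lambda>. of_real (sqrt (- 1 + ?s \<Lambda>)) * ?u \<Lambda>) \<longlongrightarrow> 0) at_top"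
    by (rule Lim_null_comparison[OF _ lim]) (simp add: norm_mult)
  define P where "P = sqrt ((2 * pi) ^ 3)"
  have lim': "((\<lambda>\<Lambda>. SJ_mode a g kv \<Lambda> \<eta> x) \<longlongrightarrow>
      exp (\<i> * of_real (kv \<bullet> x)) / of_real (sqrt (2 * (2 * pi) ^ 3) * a \<eta>) *
      (of_real (sqrt (1 + 1)) * g \<eta> - 0)) at_top"
    unfolding SJ_mode_def mult.assoc[of "complex_of_real (sqrt (- 1 + _))"]
    by (intro tendsto_intros s u)
  have root: "sqrt (2 * (2 * pi) ^ 3) = sqrt 2 * P" unfolding P_def by (rule real_sqrt_mult)
  have "exp (\<i> * of_real (kv \<bullet> x)) / of_real (sqrt (2 * (2 * pi) ^ 3) * a \<eta>) *
      (of_real (sqrt (1 + 1)) * g \<eta> - 0)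
      = exp (\<i> * of_real (kv \<bullet> x)) / of_real (P * a \<eta>) * g \<eta>"
    unfolding root by simp
  with lim' show ?thesis by (simp only: P_def)
qed

text \<open>The integrability conjunct guards the limit: the integral of a non-integrable function
  is 0 by convention, and the ratio could then vanish without content.\<close>

theorem mainTheorem2:
  fixes m \<alpha> mt k :: real
    and a :: "real \<Rightarrow> real"
    and kv :: "real^3"
    and l :: complex
    and g :: "real \<Rightarrow> complex"
  assumes "m > 0" and "\<alpha> > 0"
    and "\<And>\<eta>. \<eta> > 0 \<Longrightarrow> a \<eta> = \<alpha> * \<eta>"
    and "mt = \<alpha> * m"
    and "k = norm kv"
    and "l = - \<i> * of_real (k\<^sup>2) / (4 * of_real mt)"
    and "\<And>\<eta>. \<eta> > 0 \<Longrightarrow>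
           g \<eta> = of_real (exp (- pi * k\<^sup>2 / (8 * mt)) / (sqrt (2 * m) * sqrt (a \<eta>)))
                   * whittaker_W l (1 / 4) (\<i> * of_real (mt * \<eta>\<^sup>2))"
  shows "mode_equation m a k g
    \<and> wronskian_normalized g
    \<and> (\<forall>\<Lambda>>0. set_integrable lborel {0<..<\<Lambda>} (eta_integrand a g g)
            \<and> set_integrable lborel {0<..<\<Lambda>} (eta_integrand a g (conj_fun g)))
    \<and> ((\<lambda>\<Lambda>. cmod (eta_inner a \<Lambda> g (conj_fun g)) / Re (eta_inner a \<Lambda> g g)) \<longlongrightarrow> 0) at_top
    \<and> (\<forall>\<eta>>0. \<forall>x :: real^3.
         ((\<lambda>\<Lambda>. SJ_mode a g kv \<Lambda> \<eta> x) \<longlongrightarrow>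
            exp (\<i> * of_real (kv \<bullet> x)) * of_real (exp (- pi * k\<^sup>2 / (8 * mt)))
              / of_real (sqrt (2 * m * (2 * pi) ^ 3) * a \<eta> powr (3 / 2))
              * whittaker_W (- \<i> * of_real (k\<^sup>2) / (4 * of_real mt)) (1 / 4)
                  (\<i> * of_real (mt * \<eta>\<^sup>2))) at_top)"
proof -
  note a = assms(3) and l = assms(6) and g = assms(7)
  have mt: "mt > 0" using assms by simp
  define e where "e = exp (- pi * k\<^sup>2 / (8 * mt))"
  define c where "c = e / (sqrt (2 * m) * sqrt \<alpha>)"
  have c: "c > 0" using assms by (simp add: c_def e_def)
  \<comment> \<open>Imaginary l with \<mu> = 1/4 meets both parameter conditions of the existence
    theorem, with real parts 3/4 and -1/4.\<close>
  have "Re l = 0" unfolding l by (simp add: Re_divide_of_real[of _ "4 * mt", simplified])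
  then obtain F where F: "whittaker_solution l (1 / 4) F"
    using whittaker_solution_exists[of "1 / 4" l] by auto
  have "g \<eta> = of_real (c * \<eta> powr (- 1 / 2)) * F (Complex (ln (mt * \<eta>\<^sup>2)) (pi / 2))" if \<eta>: "\<eta> > 0" for \<eta>
  proof -
    have "whittaker_W l (1 / 4) (\<i> * of_real (mt * \<eta>\<^sup>2)) = F (Complex (ln (mt * \<eta>\<^sup>2)) (pi / 2))"
      using whittaker_W_eqI[OF F, of "\<i> * of_real (mt * \<eta>\<^sup>2)"] Ln_imaginary(1)[of "mt * \<eta>\<^sup>2"] mt \<eta> by simp
    moreover have "e / (sqrt (2 * m) * sqrt (a \<eta>)) = c * \<eta> powr (- 1 / 2)"
      using \<eta> a[OF \<eta>] by (simp add: c_def powr_minus powr_half_sqrt real_sqrt_mult field_simps)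
    ultimately show ?thesis unfolding g[OF \<eta>] e_def by metis
  qed
  then obtain g1 where "oscillator_mode k mt (c\<^sup>2 * exp (pi * k\<^sup>2 / (4 * mt))) g g1"
    using whittaker_oscillator_mode[OF mt c l F] by blast
  \<comment> \<open>e is the reciprocal of |z^l| on the ray, so the exponentials cancel and 2 m
    \<alpha> = 2 mt remains. With this amplitude the Wronskian 2 i M A equals i.\<close>
  moreover have "c\<^sup>2 * exp (pi * k\<^sup>2 / (4 * mt)) = 1 / (2 * mt)"
  proof -
    have "e\<^sup>2 * exp (pi * k\<^sup>2 / (4 * mt)) = 1"
      unfolding e_def by (simp add: power2_eq_square exp_add[symmetric])
    moreover have "c\<^sup>2 = e\<^sup>2 / (2 * mt)"
      using assms by (simp add: c_def power_divide power_mult_distrib)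
    ultimately show ?thesis by (simp add: field_simps)
  qed
  ultimately interpret oscillator_mode k mt "1 / (2 * mt)" g g1 by simp

  have "mode_equation m a k g"
    unfolding mode_equation_def
  proof (intro exI allI impI conjI)
    fix \<eta> :: real assume \<eta>: "\<eta> > 0"
    show "(g has_vector_derivative g1 \<eta>) (at \<eta>)" by (rule d0[OF \<eta>])
    show "(g1 has_vector_derivative - (of_real (k\<^sup>2 + mt\<^sup>2 * \<eta>\<^sup>2) * g \<eta>)) (at \<eta>)" by (rule d1[OF \<eta>])
    \<comment> \<open>a is prescribed for positive arguments only, so its derivatives are computed
      from equality on an open neighbourhood.\<close>
    have da: "deriv a t = \<alpha>" if t: "t > 0" for t
    proof -
      have "deriv a t = deriv (\<lambda>t. \<alpha> * t) t"
        using eventually_mono[OF eventually_nhds_in_open[of "{0<..}" t] a] t by (intro deriv_cong_ev) auto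
      then show ?thesis by simp
    qed
    have "deriv (deriv a) \<eta> = deriv (\<lambda>_. \<alpha>) \<eta>"
      using eventually_mono[OF eventually_nhds_in_open[of "{0<..}" \<eta>] da] \<eta> by (intro deriv_cong_ev) auto
    then show "- (of_real (k\<^sup>2 + mt\<^sup>2 * \<eta>\<^sup>2) * g \<eta>)
        + of_real (k\<^sup>2 + m\<^sup>2 * (a \<eta>)\<^sup>2 - deriv (deriv a) \<eta> / a \<eta>) * g \<eta> = 0"
      using a[OF \<eta>] assms(4) by (simp add: power_mult_distrib mult_ac)
  qed
  moreover have "wronskian_normalized g"
    unfolding wronskian_normalized_def
  proof (intro allI impI conjI)
    fix \<eta> :: real assume \<eta>: "\<eta> > 0"
    show "g differentiable (at \<eta>)" using d0[OF \<eta>] by (rule differentiableI_vector)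
    show "g \<eta> * vector_derivative (conj_fun g) (at \<eta>) - cnj (g \<eta>) * vector_derivative g (at \<eta>) = \<i>"
      using wronskian[OF \<eta>] mt vector_derivative_at[OF d0[OF \<eta>]]
        vector_derivative_at[OF has_vector_derivative_cnj[OF d0[OF \<eta>]]] by simp
  qed
  moreover have gg: "eta_integrand a g g \<eta> = of_real (\<alpha>\<^sup>2) * (cnj (g \<eta>) * g \<eta> * of_real (\<eta>\<^sup>2))"
    and gc: "eta_integrand a g (conj_fun g) \<eta> = of_real (\<alpha>\<^sup>2) * cnj ((g \<eta>)\<^sup>2 * of_real (\<eta>\<^sup>2))"
    if "\<eta> > 0" for \<eta>
    using a[OF that] by (simp_all add: eta_integrand_def power2_eq_square)
  have "set_integrable lborel {0<..<\<Lambda>} (eta_integrand a g g)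
      \<and> set_integrable lborel {0<..<\<Lambda>} (eta_integrand a g (conj_fun g))" for \<Lambda>
  proof
    have "set_integrable lborel {0<..<\<Lambda>} (\<lambda>\<eta>. of_real (\<alpha>\<^sup>2) * (cnj (g \<eta>) * g \<eta> * of_real (\<eta>\<^sup>2)))"
      by (intro set_integrable_mult_right integrable_norm_square)
    then show "set_integrable lborel {0<..<\<Lambda>} (eta_integrand a g g)"
      by (rule set_integrable_cong[THEN iffD2, rotated -1]) (auto simp: gg)
    have "set_integrable lborel {0<..<\<Lambda>} (\<lambda>\<eta>. of_real (\<alpha>\<^sup>2) * cnj ((g \<eta>)\<^sup>2 * of_real (\<eta>\<^sup>2)))"
      by (rule integrable_Ioo[where K = "\<alpha>\<^sup>2 * \<Lambda>\<^sup>2"])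
        (auto intro!: continuous_intros continuous_g mult_left_mono power_mono mult_mono simp: norm_mult norm_power mult_ac)
    then show "set_integrable lborel {0<..<\<Lambda>} (eta_integrand a g (conj_fun g))"
      by (rule set_integrable_cong[THEN iffD2, rotated -1]) (auto simp: gc)
  qed
  moreover have ratio: "((\<lambda>\<Lambda>. cmod (eta_inner a \<Lambda> g (conj_fun g)) / Re (eta_inner a \<Lambda> g g)) \<longlongrightarrow> 0) at_top"
  proof -
    have "eta_inner a \<Lambda> g g = of_real (\<alpha>\<^sup>2 * (LBINT \<eta>:{0<..<\<Lambda>}. (norm (g \<eta>))\<^sup>2 * \<eta>\<^sup>2))" for \<Lambda>
    proof -
      have "eta_inner a \<Lambda> g g = (LBINT \<eta>:{0<..<\<Lambda>}. of_real (\<alpha>\<^sup>2 * ((norm (g \<eta>))\<^sup>2 * \<eta>\<^sup>2)))"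
        unfolding eta_inner_def
        by (intro set_lebesgue_integral_cong) (auto simp: gg complex_norm_square[unfolded of_real_power] mult_ac)
      then show ?thesis by (simp only: set_integral_complex_of_real set_integral_mult_right)
    qed
    \<comment> \<open>The integrand contains \<open>cnj g\<close> twice, so up to \<alpha>^2 this is
      the conjugate of the integral controlled by the virial identity; the modulus is
      unaffected.\<close>
    moreover have "eta_inner a \<Lambda> g (conj_fun g) = of_real (\<alpha>\<^sup>2) *
        cnj (LBINT \<eta>:{0<..<\<Lambda>}. (g \<eta>)\<^sup>2 * of_real (\<eta>\<^sup>2))" for \<Lambda>
    proof -
      have "eta_inner a \<Lambda> g (conj_fun g) = (LBINT \<eta>:{0<..<\<Lambda>}. of_real (\<alpha>\<^sup>2) * cnj ((g \<eta>)\<^sup>2 * of_real (\<eta>\<^sup>2)))"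
        unfolding eta_inner_def by (intro set_lebesgue_integral_cong) (auto simp: gc)
      also have "\<dots> = of_real (\<alpha>\<^sup>2) * (LBINT \<eta>:{0<..<\<Lambda>}. cnj ((g \<eta>)\<^sup>2 * of_real (\<eta>\<^sup>2)))"
        by (rule set_integral_mult_right)
      also have "(LBINT \<eta>:{0<..<\<Lambda>}. cnj ((g \<eta>)\<^sup>2 * of_real (\<eta>\<^sup>2)))
          = cnj (LBINT \<eta>:{0<..<\<Lambda>}. (g \<eta>)\<^sup>2 * of_real (\<eta>\<^sup>2))"
        unfolding set_lebesgue_integral_def complex_cnj_scaleR[symmetric] by (rule Bochner_Integration.integral_cnj)
      finally show ?thesis .
    qed
    ultimately have "cmod (eta_inner a \<Lambda> g (conj_fun g)) / Re (eta_inner a \<Lambda> g g) =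
       norm (LBINT \<eta>:{0<..<\<Lambda>}. (g \<eta>)\<^sup>2 * complex_of_real (\<eta>\<^sup>2)) / (LBINT \<eta>:{0<..<\<Lambda>}. (norm (g \<eta>))\<^sup>2 * \<eta>\<^sup>2)" for \<Lambda>
      using assms(2) by (simp add: norm_mult norm_power)
    then show ?thesis using ratio_tendsto by simp
  qed
  moreover have "((\<lambda>\<Lambda>. SJ_mode a g kv \<Lambda> \<eta> x) \<longlongrightarrow>
            exp (\<i> * of_real (kv \<bullet> x)) * of_real (exp (- pi * k\<^sup>2 / (8 * mt)))
              / of_real (sqrt (2 * m * (2 * pi) ^ 3) * a \<eta> powr (3 / 2))
              * whittaker_W (- \<i> * of_real (k\<^sup>2) / (4 * of_real mt)) (1 / 4)
                  (\<i> * of_real (mt * \<eta>\<^sup>2))) at_top" if \<eta>: "\<eta> > 0" for \<eta> x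
  proof -
    define P where "P = sqrt ((2 * pi) ^ 3)"
    have root: "sqrt (2 * m * (2 * pi) ^ 3) = sqrt (2 * m) * P" unfolding P_def by (rule real_sqrt_mult)
    have "a \<eta> > 0" using a[OF \<eta>] assms(2) \<eta> by simp
    then have "a \<eta> powr (3 / 2) = a \<eta> * sqrt (a \<eta>)"
      using powr_add[of "a \<eta>" 1 "1 / 2"] by (simp add: powr_half_sqrt)
    then have "exp (\<i> * of_real (kv \<bullet> x)) / of_real (sqrt ((2 * pi) ^ 3) * a \<eta>) * g \<eta>
      = exp (\<i> * of_real (kv \<bullet> x)) * of_real (exp (- pi * k\<^sup>2 / (8 * mt)))
              / of_real (sqrt (2 * m * (2 * pi) ^ 3) * a \<eta> powr (3 / 2))
              * whittaker_W (- \<i> * of_real (k\<^sup>2) / (4 * of_real mt)) (1 / 4)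
                  (\<i> * of_real (mt * \<eta>\<^sup>2))"
      unfolding g[OF \<eta>] l[symmetric] root P_def[symmetric] by (simp add: mult_ac)
    then show ?thesis
      using SJ_mode_tendsto[of a g kv \<eta> x] ratio by (simp add: SJ_ratio_def)
  qed
  ultimately show ?thesis by blast
qed

end
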